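(* Let $D=(v,init(v),next(v,v'),J)$ be a program and $\phi$ a $CTL^*$ formula. If $D\models\phi$, then every set of clauses $Clauses(D,\phi)$ produced by the translation system ${\textsf{Trans}}$ is satisfiable by some (semantic, not necessarily first-order definable) interpretation of its uninterpreted predicates.
   Context: Fix a first-order background theory $\mathcal{T}$ with domain $\mathcal{E}$; an assertion is a formula of $\mathcal{T}$. A program is $D=(v,init(v),next(v,v'),J)$ where $v$ is a finite tuple of variables, $init(v)$ is an assertion (or a predicate application) over $v$, $next(v,v')$ is an assertion over $v$ and a primed copy $v'$, and $J=\{J_1,\dots,J_k\}$ is a finite list of assertions over $v$ (fairness conditions). States are valuations of $v$ in $\mathcal{E}$; a path is an infinite sequence of states $s_0s_1\dots$ with $next(s_i,s_{i+1})$ for all $i$; a path is fair if every $J_i$ holds at infinitely many of its states (if $J=\emptyset$ every path is fair). $CTL^*$ formulas are in negation normal form (negation only on assertions), built from assertions with $\wedge,\vee$, temporal operators $X,G,U$ (and $F\psi=\mathit{true}\,U\,\psi$), and path quantifiers $A,E$ (over all paths from a state) and $A_f,E_f$ (over fair paths from a state). $D\models\phi$ iff every state satisfying $init$ satisfies $\phi$. A basic state formula is $Q\psi$ with $Q$ a path quantifier and $\psi$ a path formula containing no path quantifiers. $\phi_1(\phi_2)$ denotes a formula with one or more occurrences of a subformula $\phi_2$, and $\phi_1(\gamma)$ the result of replacing them by $\gamma$. Clauses (Existential Horn Clauses) are implications $body\to head$ over uninterpreted predicate symbols, with all free variables universally quantified, where bodies/heads are built from assertions and predicate applications (heads may contain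 $\exists$), together with constraints $dwf(r)$ for binary (pairs-of-states) predicates $r$. A set of clauses is satisfiable if there is an interpretation $\mathcal{I}$ assigning to each predicate symbol of arity $n$ a subset of $\mathcal{E}^n$ such that all implications are true for all values of their free variables and, for each constraint $dwf(r)$, $\mathcal{I}(r)$ is disjunctively well-founded (contained in a finite union of well-founded relations). ${\textsf{Trans}}$ is the nondeterministic recursive procedure computing $Clauses(v,init(v),next(v,v'),J,\phi)$ (write $D$ for the first four arguments) by the following rules, each applied whenever its pattern matches; any set obtainable is a result of ${\textsf{Trans}}$. (1) If $\phi_1$ is a basic state subformula of $\phi_2(\phi_1)$, with $aux$ a fresh predicate of arity $|v|$: $Clauses(D,\phi_2(\phi_1))=Clauses(v,aux(v),next,J,\phi_1)\cup Clauses(D,\phi_2(aux(v)))$. (2) For a basic state formula $Q\psi$ with $Q\in\{A,E\}$ and $Q_f$ its fair version: $Clauses(D,Q\psi)=Clauses(v,init,next,\emptyset,Q_f\psi)$. (3) For an assertion $c$ and fresh boolean variable $x_X$: $Clauses(D,A_f\psi(Xc))=Clauses(v\cup\{x_X\},init(v),next\wedge(x_X=c(v')),J,A_f\psi(x_X))$; and with $aux$ fresh of arity $|v|+1$: $Clauses(D,E_f\psi(Xc))=\{init(v)\to\exists x_X\,aux(v,x_X)\}\cup Clauses(v\cup\{x_X\},aux(v,x_X),next\wedge(x_X=c(v')),J,E_f\psi(x_X))$. (4) Same as (3) with $Gc$, fresh $x_G$, conjunct $x_G=(c(v)\wedge x_G')$ added to $next$ and $J$ replaced by $J\cup\{x_G\vee\neg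 c(v)\}$. (5) Same as (3) with $c_1Uc_2$ ($c_1,c_2$ assertions), fresh $x_U$, conjunct $x_U=(c_2(v)\vee(c_1(v)\wedge x_U'))$ added to $next$ and $J$ replaced by $J\cup\{\neg x_U\vee c_2(v)\}$. (6) For an assertion $c$, fresh $p$ (arity $|v|$) and $r,t$ (arity $2|v|$), copies $v_0,\dots,v_k$ of $v$: if $J\ne\emptyset$, $Clauses(D,A_fc)=\{init(v)\wedge\neg c(v)\to p(v),\ next(v,v')\wedge p(v)\to p(v'),\ p(v_0)\wedge\bigwedge_{i=1}^{k}(t(v_{i-1},v_i)\wedge J_i(v_i))\to r(v_0,v_k),\ dwf(r),\ next(v,v')\to t(v,v'),\ t(v,v')\wedge next(v',v'')\to t(v,v'')\}$; if $J=\emptyset$, the same but with the third clause replaced by $p(v)\wedge t(v,v')\to r(v,v')$. (7) For an assertion $c$, fresh $q_1,\dots,q_k$ (arity $|v|$), $r_1,\dots,r_k$ (arity $2|v|$): if $J\neq\emptyset$, $Clauses(D,E_fc)=\{init(v)\to c(v)\wedge q_1(v)\}\cup\{q_i(v)\to\exists v'.\,next(v,v')\wedge((J_i(v)\wedge q_{(i\bmod k)+1}(v'))\vee(r_i(v,v')\wedge q_i(v'))),\ dwf(r_i),\ r_i(v,v')\wedge r_i(v',v'')\to r_i(v,v'')\mid i\le k\}$; if $J=\emptyset$, with $q$ fresh: $\{init(v)\to c(v)\wedge q(v),\ q(v)\to\exists v'.\,next(v,v')\wedge q(v')\}$. (8) For an assertion $c$: $Clauses(D,c)=\{init(v)\to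 c(v)\}$. *)

theory Defs
  imports "HOL-Library.Ramsey"
begin

datatype psym = PSym (pname: nat) (arity: nat)

datatype (dead 'f, fv_trm: 'x) trm =
    Var 'x
  | Fun 'f "('f, 'x) trm list"
  | TT
  | FF

text \<open>
  \<^term>\<open>Rel\<close> applies a relation symbol of the background theory, \<^term>\<open>Pr\<close> an uninterpreted
  predicate symbol. The assertions of the background theory are the formulas without \<^term>\<open>Pr\<close>.
  The map function \<open>ren\<close> also renames bound variables, so it respects the meaning of
  a formula only for injective renamings; all renamings below are injective.
\<close>

datatype (dead 'f, dead 'r, 'x) fm =
    Tru
  | Eq "('f, 'x) trm" "('f, 'x) trm"
  | Rel 'r "('f, 'x) trm list"
  | Pr psym "('f, 'x) trm list"
  | Neg "('f, 'r, 'x) fm"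
  | And "('f, 'r, 'x) fm" "('f, 'r, 'x) fm"
  | Or "('f, 'r, 'x) fm" "('f, 'r, 'x) fm"
  | Exists 'x "('f, 'r, 'x) fm"
  | Forall 'x "('f, 'r, 'x) fm"
  for map: ren

primrec fv :: "('f, 'r, 'x) fm \<Rightarrow> 'x set" where
  "fv Tru = {}"
| "fv (Eq t u) = fv_trm t \<union> fv_trm u"
| "fv (Rel R ts) = \<Union> (fv_trm ` set ts)"
| "fv (Pr p ts) = \<Union> (fv_trm ` set ts)"
| "fv (Neg a) = fv a"
| "fv (And a b) = fv a \<union> fv b"
| "fv (Or a b) = fv a \<union> fv b"
| "fv (Exists x a) = fv a - {x}"
| "fv (Forall x a) = fv a - {x}"

primrec preds :: "('f, 'r, 'x) fm \<Rightarrow> psym set" where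
  "preds Tru = {}"
| "preds (Eq t u) = {}"
| "preds (Rel R ts) = {}"
| "preds (Pr p ts) = {p}"
| "preds (Neg a) = preds a"
| "preds (And a b) = preds a \<union> preds b"
| "preds (Or a b) = preds a \<union> preds b"
| "preds (Exists x a) = preds a"
| "preds (Forall x a) = preds a"

text \<open>
  The background theory is given by a structure with domain \<^typ>\<open>'e\<close>. Two of its elements
  represent the truth values: boolean variables are variables over \<^typ>\<open>'e\<close> compared with these
  elements, so that a predicate of arity \<open>n\<close> is a set of \<open>n\<close>-tuples over
  \<^typ>\<open>'e\<close> even if some of its arguments are boolean.
\<close>

record ('f, 'r, 'e) struct =
  fun_of :: "'f \<Rightarrow> 'e list \<Rightarrow> 'e"
  rel_of :: "'r \<Rightarrow> 'e list \<Rightarrow> bool"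
  true_of :: 'e
  false_of :: 'e

type_synonym 'e interp = "psym \<Rightarrow> 'e list set"

definition interpretation_of_preds :: "'e interp \<Rightarrow> bool" where
  "interpretation_of_preds I \<longleftrightarrow> (\<forall>p. I p \<subseteq> {es. length es = arity p})"

primrec eval_trm :: "('f, 'r, 'e) struct \<Rightarrow> ('x \<Rightarrow> 'e) \<Rightarrow> ('f, 'x) trm \<Rightarrow> 'e" where
  "eval_trm M \<rho> (Var x) = \<rho> x"
| "eval_trm M \<rho> (Fun f ts) = fun_of M f (map (eval_trm M \<rho>) ts)"
| "eval_trm M \<rho> TT = true_of M"
| "eval_trm M \<rho> FF = false_of M"

primrec eval :: "('f, 'r, 'e) struct \<Rightarrow> 'e interp \<Rightarrow> ('x \<Rightarrow> 'e) \<Rightarrow> ('f, 'r, 'x) fm \<Rightarrow> bool" where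
  "eval M I \<rho> Tru \<longleftrightarrow> True"
| "eval M I \<rho> (Eq t u) \<longleftrightarrow> eval_trm M \<rho> t = eval_trm M \<rho> u"
| "eval M I \<rho> (Rel R ts) \<longleftrightarrow> rel_of M R (map (eval_trm M \<rho>) ts)"
| "eval M I \<rho> (Pr p ts) \<longleftrightarrow> map (eval_trm M \<rho>) ts \<in> I p"
| "eval M I \<rho> (Neg a) \<longleftrightarrow> \<not> eval M I \<rho> a"
| "eval M I \<rho> (And a b) \<longleftrightarrow> eval M I \<rho> a \<and> eval M I \<rho> b"
| "eval M I \<rho> (Or a b) \<longleftrightarrow> eval M I \<rho> a \<or> eval M I \<rho> b"
| "eval M I \<rho> (Exists x a) \<longleftrightarrow> (\<exists>e. eval M I (\<rho>(x := e)) a)"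
| "eval M I \<rho> (Forall x a) \<longleftrightarrow> (\<forall>e. eval M I (\<rho>(x := e)) a)"

definition conjs :: "('f, 'r, 'x) fm list \<Rightarrow> ('f, 'r, 'x) fm" where
  "conjs as = foldr And as Tru"

definition app :: "psym \<Rightarrow> 'x list \<Rightarrow> ('f, 'r, 'x) fm" where
  "app p xs = Pr p (map Var xs)"

definition bvar :: "'x \<Rightarrow> ('f, 'r, 'x) fm" where
  "bvar x = Eq (Var x) TT"

text \<open>The equation \<open>x = a\<close> between a boolean variable and a formula:\<close>

definition beq :: "'x \<Rightarrow> ('f, 'r, 'x) fm \<Rightarrow> ('f, 'r, 'x) fm" where
  "beq x a = Or (And (Eq (Var x) TT) a) (And (Eq (Var x) FF) (Neg a))"

text \<open>
  The pair \<open>(x, i)\<close> is the variable \<open>x\<close> in the \<open>i\<close>-th copy of the program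
  variables: \<open>(x, 0)\<close> is \<open>x\<close>, \<open>(x, 1)\<close> is its primed version, and so on.
\<close>

type_synonym cvar = "nat \<times> nat"

record ('f, 'r) prog =
  vars :: "nat list"
  init :: "('f, 'r, nat) fm"
  nxt :: "('f, 'r, cvar) fm"
  fair :: "('f, 'r, nat) fm list"

definition program :: "('f, 'r) prog \<Rightarrow> bool" where
  "program D \<longleftrightarrow>
     distinct (vars D) \<and>
     fv (init D) \<subseteq> set (vars D) \<and>
     (preds (init D) = {} \<or> (\<exists>p ts. init D = Pr p ts \<and> length ts = arity p)) \<and>
     fv (nxt D) \<subseteq> set (vars D) \<times> {0, 1} \<and> preds (nxt D) = {} \<and>
     (\<forall>c \<in> set (fair D). fv c \<subseteq> set (vars D) \<and> preds c = {})"

text \<open>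
  States assign values to all variable names; those outside \<^term>\<open>vars D\<close> are never inspected.
\<close>

type_synonym 'e state = "nat \<Rightarrow> 'e"

definition step :: "('f, 'r, 'e) struct \<Rightarrow> 'e interp \<Rightarrow> ('f, 'r) prog \<Rightarrow> 'e state \<Rightarrow> 'e state \<Rightarrow> bool" where
  "step M I D s s' \<longleftrightarrow> eval M I (\<lambda>(x, i). if i = 0 then s x else s' x) (nxt D)"

definition prog_path :: "('f, 'r, 'e) struct \<Rightarrow> 'e interp \<Rightarrow> ('f, 'r) prog \<Rightarrow> (nat \<Rightarrow> 'e state) \<Rightarrow> bool" where
  "prog_path M I D \<pi> \<longleftrightarrow> (\<forall>i. step M I D (\<pi> i) (\<pi> (Suc i)))"

definition fair_path :: "('f, 'r, 'e) struct \<Rightarrow> 'e interp \<Rightarrow> ('f, 'r) prog \<Rightarrow> (nat \<Rightarrow> 'e state) \<Rightarrow> bool" where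
  "fair_path M I D \<pi> \<longleftrightarrow>
     prog_path M I D \<pi> \<and> (\<forall>c \<in> set (fair D). infinite {i. eval M I (\<pi> i) c})"

datatype quant = QA | QE | QAf | QEf

datatype (assertions: 'a) ctl =
    Asn 'a
  | Conj "'a ctl" "'a ctl"
  | Disj "'a ctl" "'a ctl"
  | Nxt "'a ctl"
  | Alw "'a ctl"
  | Unt "'a ctl" "'a ctl"
  | Qu quant "'a ctl"

abbreviation Fut :: "('f, 'r, 'x) fm ctl \<Rightarrow> ('f, 'r, 'x) fm ctl" where
  "Fut \<psi> \<equiv> Unt (Asn Tru) \<psi>"

primrec state_formula :: "'a ctl \<Rightarrow> bool" where
  "state_formula (Asn c) \<longleftrightarrow> True"
| "state_formula (Conj \<phi> \<psi>) \<longleftrightarrow> state_formula \<phi> \<and> state_formula \<psi>"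
| "state_formula (Disj \<phi> \<psi>) \<longleftrightarrow> state_formula \<phi> \<and> state_formula \<psi>"
| "state_formula (Nxt \<psi>) \<longleftrightarrow> False"
| "state_formula (Alw \<psi>) \<longleftrightarrow> False"
| "state_formula (Unt \<psi> \<chi>) \<longleftrightarrow> False"
| "state_formula (Qu q \<psi>) \<longleftrightarrow> True"

primrec quantifier_free :: "'a ctl \<Rightarrow> bool" where
  "quantifier_free (Asn c) \<longleftrightarrow> True"
| "quantifier_free (Conj \<phi> \<psi>) \<longleftrightarrow> quantifier_free \<phi> \<and> quantifier_free \<psi>"
| "quantifier_free (Disj \<phi> \<psi>) \<longleftrightarrow> quantifier_free \<phi> \<and> quantifier_free \<psi>"
| "quantifier_free (Nxt \<psi>) \<longleftrightarrow> quantifier_free \<psi>"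
| "quantifier_free (Alw \<psi>) \<longleftrightarrow> quantifier_free \<psi>"
| "quantifier_free (Unt \<psi> \<chi>) \<longleftrightarrow> quantifier_free \<psi> \<and> quantifier_free \<chi>"
| "quantifier_free (Qu q \<psi>) \<longleftrightarrow> False"

text \<open>A Boolean combination of assertions is itself an assertion:\<close>

fun as_assertion :: "('f, 'r, 'x) fm ctl \<Rightarrow> ('f, 'r, 'x) fm option" where
  "as_assertion (Asn c) = Some c"
| "as_assertion (Conj \<phi> \<psi>) =
     (case (as_assertion \<phi>, as_assertion \<psi>) of (Some c, Some d) \<Rightarrow> Some (And c d) | _ \<Rightarrow> None)"
| "as_assertion (Disj \<phi> \<psi>) =
     (case (as_assertion \<phi>, as_assertion \<psi>) of (Some c, Some d) \<Rightarrow> Some (Or c d) | _ \<Rightarrow> None)"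
| "as_assertion _ = None"

definition ctl_star_formula :: "nat list \<Rightarrow> ('f, 'r, nat) fm ctl \<Rightarrow> bool" where
  "ctl_star_formula v \<phi> \<longleftrightarrow>
     state_formula \<phi> \<and> (\<forall>c \<in> assertions \<phi>. fv c \<subseteq> set v \<and> preds c = {})"

definition seq_suffix :: "nat \<Rightarrow> (nat \<Rightarrow> 'a) \<Rightarrow> nat \<Rightarrow> 'a" where
  "seq_suffix i \<pi> = (\<lambda>j. \<pi> (i + j))"

primrec sat :: "('f, 'r, 'e) struct \<Rightarrow> 'e interp \<Rightarrow> ('f, 'r) prog \<Rightarrow> (nat \<Rightarrow> 'e state)
    \<Rightarrow> ('f, 'r, nat) fm ctl \<Rightarrow> bool" where
  "sat M I D \<pi> (Asn c) \<longleftrightarrow> eval M I (\<pi> 0) c"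
| "sat M I D \<pi> (Conj \<phi> \<psi>) \<longleftrightarrow> sat M I D \<pi> \<phi> \<and> sat M I D \<pi> \<psi>"
| "sat M I D \<pi> (Disj \<phi> \<psi>) \<longleftrightarrow> sat M I D \<pi> \<phi> \<or> sat M I D \<pi> \<psi>"
| "sat M I D \<pi> (Nxt \<psi>) \<longleftrightarrow> sat M I D (seq_suffix 1 \<pi>) \<psi>"
| "sat M I D \<pi> (Alw \<psi>) \<longleftrightarrow> (\<forall>i. sat M I D (seq_suffix i \<pi>) \<psi>)"
| "sat M I D \<pi> (Unt \<psi> \<chi>) \<longleftrightarrow>
     (\<exists>i. sat M I D (seq_suffix i \<pi>) \<chi> \<and> (\<forall>j<i. sat M I D (seq_suffix j \<pi>) \<psi>))"
| "sat M I D \<pi> (Qu q \<psi>) \<longleftrightarrow>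
     (case q of
        QA \<Rightarrow> \<forall>\<pi>'. prog_path M I D \<pi>' \<and> \<pi>' 0 = \<pi> 0 \<longrightarrow> sat M I D \<pi>' \<psi>
      | QE \<Rightarrow> \<exists>\<pi>'. prog_path M I D \<pi>' \<and> \<pi>' 0 = \<pi> 0 \<and> sat M I D \<pi>' \<psi>
      | QAf \<Rightarrow> \<forall>\<pi>'. fair_path M I D \<pi>' \<and> \<pi>' 0 = \<pi> 0 \<longrightarrow> sat M I D \<pi>' \<psi>
      | QEf \<Rightarrow> \<exists>\<pi>'. fair_path M I D \<pi>' \<and> \<pi>' 0 = \<pi> 0 \<and> sat M I D \<pi>' \<psi>)"

text \<open>
  Whether a state formula holds depends only on the first state of the sequence, which need not
  be a path. Hence evaluating it on the constant sequence gives its truth value at a state, also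
  at states from which no path starts.
\<close>

definition sat_state :: "('f, 'r, 'e) struct \<Rightarrow> 'e interp \<Rightarrow> ('f, 'r) prog \<Rightarrow> 'e state
    \<Rightarrow> ('f, 'r, nat) fm ctl \<Rightarrow> bool" where
  "sat_state M I D s \<phi> \<longleftrightarrow> sat M I D (\<lambda>_. s) \<phi>"

definition models :: "('f, 'r, 'e) struct \<Rightarrow> 'e interp \<Rightarrow> ('f, 'r) prog
    \<Rightarrow> ('f, 'r, nat) fm ctl \<Rightarrow> bool" where
  "models M I D \<phi> \<longleftrightarrow> (\<forall>s. eval M I s (init D) \<longrightarrow> sat_state M I D s \<phi>)"

text \<open>
  \<open>replaces \<phi> \<gamma> \<psi> \<psi>'\<close>: \<open>\<psi>'\<close> results from \<open>\<psi>\<close> by replacing one or more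
  occurrences of \<open>\<phi>\<close> by \<open>\<gamma>\<close>.
\<close>

inductive replace1 :: "'a ctl \<Rightarrow> 'a ctl \<Rightarrow> 'a ctl \<Rightarrow> 'a ctl \<Rightarrow> bool" for \<phi> \<gamma> where
  here: "replace1 \<phi> \<gamma> \<phi> \<gamma>"
| Conj1: "replace1 \<phi> \<gamma> \<psi> \<psi>' \<Longrightarrow> replace1 \<phi> \<gamma> (Conj \<psi> \<chi>) (Conj \<psi>' \<chi>)"
| Conj2: "replace1 \<phi> \<gamma> \<chi> \<chi>' \<Longrightarrow> replace1 \<phi> \<gamma> (Conj \<psi> \<chi>) (Conj \<psi> \<chi>')"
| Disj1: "replace1 \<phi> \<gamma> \<psi> \<psi>' \<Longrightarrow> replace1 \<phi> \<gamma> (Disj \<psi> \<chi>) (Disj \<psi>' \<chi>)"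
| Disj2: "replace1 \<phi> \<gamma> \<chi> \<chi>' \<Longrightarrow> replace1 \<phi> \<gamma> (Disj \<psi> \<chi>) (Disj \<psi> \<chi>')"
| Nxt: "replace1 \<phi> \<gamma> \<psi> \<psi>' \<Longrightarrow> replace1 \<phi> \<gamma> (Nxt \<psi>) (Nxt \<psi>')"
| Alw: "replace1 \<phi> \<gamma> \<psi> \<psi>' \<Longrightarrow> replace1 \<phi> \<gamma> (Alw \<psi>) (Alw \<psi>')"
| Unt1: "replace1 \<phi> \<gamma> \<psi> \<psi>' \<Longrightarrow> replace1 \<phi> \<gamma> (Unt \<psi> \<chi>) (Unt \<psi>' \<chi>)"
| Unt2: "replace1 \<phi> \<gamma> \<chi> \<chi>' \<Longrightarrow> replace1 \<phi> \<gamma> (Unt \<psi> \<chi>) (Unt \<psi> \<chi>')"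
| Qu: "replace1 \<phi> \<gamma> \<psi> \<psi>' \<Longrightarrow> replace1 \<phi> \<gamma> (Qu q \<psi>) (Qu q \<psi>')"

definition replaces :: "'a ctl \<Rightarrow> 'a ctl \<Rightarrow> 'a ctl \<Rightarrow> 'a ctl \<Rightarrow> bool" where
  "replaces \<phi> \<gamma> = (replace1 \<phi> \<gamma>)\<^sup>+\<^sup>+"

text \<open>
  \<open>Imp b xs h\<close> is the implication \<open>b \<rightarrow> \<exists>xs. h\<close>, universally closed;
  \<open>DWF r\<close> is the constraint that \<open>r\<close>, of arity \<open>2n\<close>, is disjunctively well-founded
  as a relation between \<open>n\<close>-tuples.
\<close>

datatype ('f, 'r) clause =
    Imp "('f, 'r, cvar) fm" "cvar list" "('f, 'r, cvar) fm"
  | DWF psym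

definition pair_rel :: "'e list set \<Rightarrow> ('e list \<times> 'e list) set" where
  "pair_rel R = {(es, es'). length es = length es' \<and> es @ es' \<in> R}"

text \<open>
  \<^const>\<open>wf\<close> excludes infinite chains to the left whereas well-foundedness of a transition relation
  excludes infinite chains \<open>r(s\<^sub>0,s\<^sub>1), r(s\<^sub>1,s\<^sub>2), ...\<close>; hence the converse.
\<close>

primrec holds :: "('f, 'r, 'e) struct \<Rightarrow> 'e interp \<Rightarrow> ('f, 'r) clause \<Rightarrow> bool" where
  "holds M I (Imp b xs h) \<longleftrightarrow>
     (\<forall>\<rho>. eval M I \<rho> b \<longrightarrow> (\<exists>\<rho>'. (\<forall>y. y \<notin> set xs \<longrightarrow> \<rho>' y = \<rho> y) \<and> eval M I \<rho>' h))"
| "holds M I (DWF r) \<longleftrightarrow> disj_wf ((pair_rel (I r))\<inverse>)"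

definition satisfiable :: "('f, 'r, 'e) struct \<Rightarrow> ('f, 'r) clause set \<Rightarrow> bool" where
  "satisfiable M C \<longleftrightarrow> (\<exists>I. interpretation_of_preds I \<and> (\<forall>cl \<in> C. holds M I cl))"

text \<open>\<open>cp i v\<close> is the \<open>i\<close>-th copy of the tuple \<open>v\<close>, and \<open>at_copy i c\<close> is \<open>c\<close> over that copy.\<close>

definition cp :: "nat \<Rightarrow> nat list \<Rightarrow> cvar list" where
  "cp i v = map (\<lambda>x. (x, i)) v"

definition at_copy :: "nat \<Rightarrow> ('f, 'r, nat) fm \<Rightarrow> ('f, 'r, cvar) fm" where
  "at_copy i c = ren (\<lambda>x. (x, i)) c"

definition shift_copy :: "('f, 'r, cvar) fm \<Rightarrow> ('f, 'r, cvar) fm" where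
  "shift_copy a = ren (\<lambda>(x, i). (x, Suc i)) a"

definition extend_prog :: "('f, 'r) prog \<Rightarrow> nat \<Rightarrow> ('f, 'r, cvar) fm \<Rightarrow> ('f, 'r, nat) fm list \<Rightarrow> ('f, 'r) prog" where
  "extend_prog D x a js =
     D\<lparr>vars := vars D @ [x], nxt := And (nxt D) a, fair := fair D @ js\<rparr>"

text \<open>
  \<open>elim_temporal v x \<theta> a js\<close>: in a program over \<open>v\<close>, the temporal formula \<open>\<theta>\<close> may be
  replaced by the fresh boolean variable \<open>x\<close>, at the price of the conjunct \<open>a\<close> in the
  transition relation and the additional fairness conditions \<open>js\<close>.
\<close>

inductive elim_temporal :: "nat list \<Rightarrow> nat \<Rightarrow> ('f, 'r, nat) fm ctl
    \<Rightarrow> ('f, 'r, cvar) fm \<Rightarrow> ('f, 'r, nat) fm list \<Rightarrow> bool" for v where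
  elim_X: "x \<notin> set v \<Longrightarrow> as_assertion \<psi> = Some c \<Longrightarrow>
     elim_temporal v x (Nxt \<psi>) (beq (x, 0) (at_copy 1 c)) []"
| elim_G: "x \<notin> set v \<Longrightarrow> as_assertion \<psi> = Some c \<Longrightarrow>
     elim_temporal v x (Alw \<psi>) (beq (x, 0) (And (at_copy 0 c) (bvar (x, 1))))
       [Or (bvar x) (Neg c)]"
| elim_U: "x \<notin> set v \<Longrightarrow> as_assertion \<psi>1 = Some c1 \<Longrightarrow> as_assertion \<psi>2 = Some c2 \<Longrightarrow>
     elim_temporal v x (Unt \<psi>1 \<psi>2) (beq (x, 0) (Or (at_copy 0 c2) (And (at_copy 0 c1) (bvar (x, 1)))))
       [Or (Neg (bvar x)) c2]"

definition clauses_Af :: "('f, 'r) prog \<Rightarrow> ('f, 'r, nat) fm \<Rightarrow> psym \<Rightarrow> psym \<Rightarrow> psym \<Rightarrow> ('f, 'r) clause set" where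
  "clauses_Af D c p r t =
    (let v = vars D; k = length (fair D) in
     {Imp (And (at_copy 0 (init D)) (Neg (at_copy 0 c))) [] (app p (cp 0 v)),
      Imp (And (nxt D) (app p (cp 0 v))) [] (app p (cp 1 v)),
      (if fair D \<noteq> [] then
         Imp (And (app p (cp 0 v))
               (conjs (map (\<lambda>i. And (app t (cp (i - 1) v @ cp i v)) (at_copy i (fair D ! (i - 1)))) [1..<k + 1])))
           [] (app r (cp 0 v @ cp k v))
       else
         Imp (And (app p (cp 0 v)) (app t (cp 0 v @ cp 1 v))) [] (app r (cp 0 v @ cp 1 v))),
      DWF r,
      Imp (nxt D) [] (app t (cp 0 v @ cp 1 v)),
      Imp (And (app t (cp 0 v @ cp 1 v)) (shift_copy (nxt D))) [] (app t (cp 0 v @ cp 2 v))})"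

text \<open>
  The lists \<open>J\<close>, \<open>qs\<close>, \<open>rs\<close> are indexed from 0, so the cyclic successor of \<open>i\<close> is
  \<open>(i + 1) mod k\<close>.
\<close>

definition clauses_Ef :: "('f, 'r) prog \<Rightarrow> ('f, 'r, nat) fm \<Rightarrow> psym list \<Rightarrow> psym list \<Rightarrow> ('f, 'r) clause set" where
  "clauses_Ef D c qs rs =
    (let v = vars D; J = fair D; k = length J in
     {Imp (at_copy 0 (init D)) [] (And (at_copy 0 c) (app (qs ! 0) (cp 0 v)))} \<union>
     (\<Union>i<k.
       {Imp (app (qs ! i) (cp 0 v)) (cp 1 v)
          (And (nxt D)
            (Or (And (at_copy 0 (J ! i)) (app (qs ! ((i + 1) mod k)) (cp 1 v)))
                (And (app (rs ! i) (cp 0 v @ cp 1 v)) (app (qs ! i) (cp 1 v))))),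
        DWF (rs ! i),
        Imp (And (app (rs ! i) (cp 0 v @ cp 1 v)) (app (rs ! i) (cp 1 v @ cp 2 v))) []
          (app (rs ! i) (cp 0 v @ cp 2 v))}))"

definition clauses_Ef_unfair :: "('f, 'r) prog \<Rightarrow> ('f, 'r, nat) fm \<Rightarrow> psym \<Rightarrow> ('f, 'r) clause set" where
  "clauses_Ef_unfair D c q =
    (let v = vars D in
     {Imp (at_copy 0 (init D)) [] (And (at_copy 0 c) (app q (cp 0 v))),
      Imp (app q (cp 0 v)) (cp 1 v) (And (nxt D) (app q (cp 1 v)))})"

text \<open>
  \<open>translates U D \<phi> C U'\<close>: \<open>C\<close> is a possible result of \<open>Clauses(D, \<phi>)\<close> where \<open>U\<close>
  are the predicate symbols in use before the call and \<open>U'\<close> those in use after it. Threading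
  these sets keeps the fresh symbols of the two calls spawned by \<open>split_state\<close> apart.
\<close>

inductive translates :: "psym set \<Rightarrow> ('f, 'r) prog \<Rightarrow> ('f, 'r, nat) fm ctl
    \<Rightarrow> ('f, 'r) clause set \<Rightarrow> psym set \<Rightarrow> bool" where
  split_state:
    "quantifier_free \<psi> \<Longrightarrow> \<phi>\<^sub>1 = Qu q \<psi> \<Longrightarrow>
     aux \<notin> U \<Longrightarrow> arity aux = length (vars D) \<Longrightarrow>
     replaces \<phi>\<^sub>1 (Asn (app aux (vars D))) \<phi>\<^sub>2 \<phi>\<^sub>2' \<Longrightarrow>
     translates (insert aux U) (D\<lparr>init := app aux (vars D)\<rparr>) \<phi>\<^sub>1 C\<^sub>1 U\<^sub>1 \<Longrightarrow>
     translates U\<^sub>1 D \<phi>\<^sub>2' C\<^sub>2 U\<^sub>2 \<Longrightarrow>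
     translates U D \<phi>\<^sub>2 (C\<^sub>1 \<union> C\<^sub>2) U\<^sub>2"
| path_A:
    "quantifier_free \<psi> \<Longrightarrow> translates U (D\<lparr>fair := []\<rparr>) (Qu QAf \<psi>) C U' \<Longrightarrow>
     translates U D (Qu QA \<psi>) C U'"
| path_E:
    "quantifier_free \<psi> \<Longrightarrow> translates U (D\<lparr>fair := []\<rparr>) (Qu QEf \<psi>) C U' \<Longrightarrow>
     translates U D (Qu QE \<psi>) C U'"
| temporal_Af:
    "quantifier_free \<psi> \<Longrightarrow> elim_temporal (vars D) x \<theta> a js \<Longrightarrow>
     replaces \<theta> (Asn (bvar x)) \<psi> \<psi>' \<Longrightarrow>
     translates U (extend_prog D x a js) (Qu QAf \<psi>') C U' \<Longrightarrow>
     translates U D (Qu QAf \<psi>) C U'"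
| temporal_Ef:
    "quantifier_free \<psi> \<Longrightarrow> elim_temporal (vars D) x \<theta> a js \<Longrightarrow>
     replaces \<theta> (Asn (bvar x)) \<psi> \<psi>' \<Longrightarrow>
     aux \<notin> U \<Longrightarrow> arity aux = length (vars D) + 1 \<Longrightarrow>
     translates (insert aux U) ((extend_prog D x a js)\<lparr>init := app aux (vars D @ [x])\<rparr>) (Qu QEf \<psi>') C U' \<Longrightarrow>
     translates U D (Qu QEf \<psi>)
       (insert (Imp (at_copy 0 (init D)) [(x, 0)] (app aux (cp 0 (vars D @ [x])))) C) U'"
| assertion_Af:
    "as_assertion \<psi> = Some c \<Longrightarrow> distinct [p, r, t] \<Longrightarrow> {p, r, t} \<inter> U = {} \<Longrightarrow>
     arity p = length (vars D) \<Longrightarrow> arity r = 2 * length (vars D) \<Longrightarrow> arity t = 2 * length (vars D) \<Longrightarrow>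
     translates U D (Qu QAf \<psi>) (clauses_Af D c p r t) (U \<union> {p, r, t})"
| assertion_Ef:
    "as_assertion \<psi> = Some c \<Longrightarrow> fair D \<noteq> [] \<Longrightarrow>
     length qs = length (fair D) \<Longrightarrow> length rs = length (fair D) \<Longrightarrow>
     distinct (qs @ rs) \<Longrightarrow> set (qs @ rs) \<inter> U = {} \<Longrightarrow>
     \<forall>q \<in> set qs. arity q = length (vars D) \<Longrightarrow> \<forall>r \<in> set rs. arity r = 2 * length (vars D) \<Longrightarrow>
     translates U D (Qu QEf \<psi>) (clauses_Ef D c qs rs) (U \<union> set (qs @ rs))"
| assertion_Ef_unfair:
    "as_assertion \<psi> = Some c \<Longrightarrow> fair D = [] \<Longrightarrow> q \<notin> U \<Longrightarrow> arity q = length (vars D) \<Longrightarrow>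
     translates U D (Qu QEf \<psi>) (clauses_Ef_unfair D c q) (insert q U)"
| assertion:
    "as_assertion \<phi> = Some c \<Longrightarrow>
     translates U D \<phi> {Imp (at_copy 0 (init D)) [] (at_copy 0 c)} U"

definition preds_prog :: "('f, 'r) prog \<Rightarrow> psym set" where
  "preds_prog D = preds (init D) \<union> preds (nxt D) \<union> \<Union> (preds ` set (fair D))"

definition Clauses :: "('f, 'r) prog \<Rightarrow> ('f, 'r, nat) fm ctl \<Rightarrow> ('f, 'r) clause set \<Rightarrow> bool" where
  "Clauses D \<phi> C \<longleftrightarrow> (\<exists>U'. translates (preds_prog D \<union> \<Union> (preds ` assertions \<phi>)) D \<phi> C U')"

end

theory Submission
  imports Defs
begin

text \<open>
  Every rule introduces fresh predicate symbols only, so an interpretation of the symbols in use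
  under which the program satisfies the formula can be extended step by step. The auxiliary
  predicates of the first five rules denote the states that satisfy the formula they replace; the
  added fairness conditions force the boolean variables of \<open>G\<close> and \<open>U\<close> to take exactly the
  truth values of these formulas along fair paths.
  For a universal assertion, \<open>p\<close> denotes the states reachable from a violating initial state, \<open>t\<close> the
  transitive closure of the transition relation and \<open>r\<close> one round of visits to all fairness
  conditions; an infinite \<open>r\<close>-chain would unfold to a violating fair path, so \<open>r\<close> is even
  well-founded. For an existential assertion, every \<open>q\<^sub>i\<close> denotes the states with a fair path, and
  \<open>r\<^sub>i\<close> decreases the least time at which a fair path can reach \<open>J\<^sub>i\<close>.
\<close>

section \<open>Evaluation\<close>

text \<open>Clauses produced by one call must stay true while later calls interpret further symbols.
  The induction therefore does not aim at a single model: it shows that all interpretations which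
  agree with some extension on the symbols in use after the call are models of the clauses. A second
  obstacle is the gap between states and tuples. A state assigns values to all names, whereas a
  predicate contains tuples of values of the program variables. Every notion that becomes the
  meaning of a predicate has to be shown to depend on these variables alone, which is the purpose of
  the many statements about \<open>agree\<close>. Finally, a boolean variable that stands for a
  temporal formula is guaranteed to be right on fair paths only. So its correctness is stated for
  one fair path and its suffixes, and only quantifier-free formulas may be rewritten with
  it.\<close>

definition agree :: "'a set \<Rightarrow> ('a \<Rightarrow> 'b) \<Rightarrow> ('a \<Rightarrow> 'b) \<Rightarrow> bool" where
  "agree A f g \<longleftrightarrow> (\<forall>x\<in>A. f x = g x)"

lemma agree_refl [simp]: "agree A f f"
  by (simp add: agree_def)

lemma agree_sym: "agree A f g \<Longrightarrow> agree A g f"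
  by (simp add: agree_def)

lemma agree_trans: "agree A f g \<Longrightarrow> agree A g h \<Longrightarrow> agree A f h"
  by (simp add: agree_def)

lemma agree_mono: "agree B f g \<Longrightarrow> A \<subseteq> B \<Longrightarrow> agree A f g"
  by (auto simp: agree_def)

lemma eval_trm_cong: "agree (fv_trm t) \<rho> \<rho>' \<Longrightarrow> eval_trm M \<rho> t = eval_trm M \<rho>' t"
proof (induction t)
  case (Fun f ts)
  have "eval_trm M \<rho> u = eval_trm M \<rho>' u" if "u \<in> set ts" for u
    using Fun that by (auto simp: agree_def)
  then show ?case by (simp cong: map_cong)
qed (auto simp: agree_def)

lemma map_eval_trm_cong:
  assumes "agree (\<Union> (fv_trm ` set ts)) \<rho> \<rho>'"
  shows "map (eval_trm M \<rho>) ts = map (eval_trm M \<rho>') ts"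
proof (rule map_cong[OF refl])
  fix t assume "t \<in> set ts"
  then show "eval_trm M \<rho> t = eval_trm M \<rho>' t"
    using assms by (intro eval_trm_cong) (auto simp: agree_def)
qed

text \<open>Valuation and interpretation vary together because both kinds of change occur later: a
  fresh symbol alters the interpretation, and passing through tuples alters a state outside the
  program variables.\<close>

lemma eval_cong:
  "agree (fv a) \<rho> \<rho>' \<Longrightarrow> agree (preds a) I I' \<Longrightarrow> eval M I \<rho> a = eval M I' \<rho>' a"
proof (induction a arbitrary: \<rho> \<rho>')
  case (Eq t u)
  then show ?case using eval_trm_cong[of t \<rho> \<rho>' M] eval_trm_cong[of u \<rho> \<rho>' M]
    by (simp add: agree_def)
next
  case (Rel R ts)
  then show ?case using map_eval_trm_cong[of ts \<rho> \<rho>' M] by (simp only: eval.simps fv.simps)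
next
  case (Pr p ts)
  then show ?case using map_eval_trm_cong[of ts \<rho> \<rho>' M]
    by (simp only: eval.simps fv.simps preds.simps) (simp add: agree_def)
next
  case (And a b)
  then have "eval M I \<rho> a = eval M I' \<rho>' a" "eval M I \<rho> b = eval M I' \<rho>' b"
    by (simp_all add: agree_def)
  then show ?case by simp
next
  case (Or a b)
  then have "eval M I \<rho> a = eval M I' \<rho>' a" "eval M I \<rho> b = eval M I' \<rho>' b"
    by (simp_all add: agree_def)
  then show ?case by simp
next
  case (Exists x a)
  have "eval M I (\<rho>(x := e)) a = eval M I' (\<rho>'(x := e)) a" for e
    using Exists.prems by (intro Exists.IH) (auto simp: agree_def)
  then show ?case by simp
next
  case (Forall x a)
  have "eval M I (\<rho>(x := e)) a = eval M I' (\<rho>'(x := e)) a" for e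
    using Forall.prems by (intro Forall.IH) (auto simp: agree_def)
  then show ?case by simp
qed simp_all

lemma eval_trm_map: "eval_trm M \<rho> (map_trm f t) = eval_trm M (\<lambda>x. \<rho> (f x)) t"
proof (induction t)
  case (Fun g ts)
  then have "map (eval_trm M \<rho>) (map (map_trm f) ts) = map (eval_trm M (\<lambda>x. \<rho> (f x))) ts"
    unfolding map_map by (intro map_cong[OF refl]) (simp only: comp_apply)
  then show ?case by (simp only: trm.map eval_trm.simps)
qed simp_all

lemma eval_ren: "inj f \<Longrightarrow> eval M I \<rho> (ren f a) = eval M I (\<lambda>x. \<rho> (f x)) a"
proof (induction a arbitrary: \<rho>)
  case (Exists x a)
  have "(\<lambda>y. (\<rho>(f x := e)) (f y)) = (\<lambda>y. \<rho> (f y))(x := e)" for e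
    using Exists.prems by (auto simp: fun_eq_iff inj_eq)
  then show ?case using Exists by (simp only: fm.map eval.simps)
next
  case (Forall x a)
  have "(\<lambda>y. (\<rho>(f x := e)) (f y)) = (\<lambda>y. \<rho> (f y))(x := e)" for e
    using Forall.prems by (auto simp: fun_eq_iff inj_eq)
  then show ?case using Forall by (simp only: fm.map eval.simps)
qed (simp_all add: eval_trm_map comp_def)

lemma fv_ren: "inj f \<Longrightarrow> fv (ren f a) = f ` fv a"
  by (induction a) (auto simp: trm.set_map inj_eq)

lemma preds_ren [simp]: "preds (ren f a) = preds a"
  by (induction a) simp_all

lemma inj_copy: "inj (\<lambda>x. (x, i))"
  by (auto simp: inj_def)

lemma eval_at_copy [simp]: "eval M I \<rho> (at_copy i c) = eval M I (\<lambda>x. \<rho> (x, i)) c"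
  by (simp add: at_copy_def eval_ren[OF inj_copy])

lemma fv_at_copy [simp]: "fv (at_copy i c) = (\<lambda>x. (x, i)) ` fv c"
  by (simp add: at_copy_def fv_ren[OF inj_copy])

lemma preds_at_copy [simp]: "preds (at_copy i c) = preds c"
  by (simp add: at_copy_def)

lemma eval_shift_copy [simp]:
  "eval M I \<rho> (shift_copy a) = eval M I (\<lambda>(x, i). \<rho> (x, Suc i)) a"
proof -
  have "inj (\<lambda>(x, i). (x, Suc i))" by (auto simp: inj_def)
  from eval_ren[OF this] show ?thesis
    unfolding shift_copy_def by (simp add: case_prod_unfold)
qed

lemma eval_app [simp]: "eval M I \<rho> (app p xs) \<longleftrightarrow> map \<rho> xs \<in> I p"
  by (simp add: app_def comp_def)

lemma fv_app [simp]: "fv (app p xs) = set xs"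
  by (simp add: app_def)

lemma preds_app [simp]: "preds (app p xs) = {p}"
  by (simp add: app_def)

lemma map_cp [simp]: "map \<rho> (cp i v) = map (\<lambda>x. \<rho> (x, i)) v"
  by (simp add: cp_def comp_def)

lemma set_cp [simp]: "set (cp i v) = (\<lambda>x. (x, i)) ` set v"
  by (simp add: cp_def)

lemma eval_bvar [simp]: "eval M I \<rho> (bvar x) \<longleftrightarrow> \<rho> x = true_of M"
  by (simp add: bvar_def)

lemma eval_beq [simp]:
  "eval M I \<rho> (beq x a) \<longleftrightarrow> \<rho> x = (if eval M I \<rho> a then true_of M else false_of M)"
  by (auto simp: beq_def)

lemma fv_bvar [simp]: "fv (bvar x) = {x}"
  by (simp add: bvar_def)

lemma preds_bvar [simp]: "preds (bvar x) = {}"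
  by (simp add: bvar_def)

lemma fv_beq [simp]: "fv (beq x a) = insert x (fv a)"
  by (auto simp: beq_def)

lemma preds_beq [simp]: "preds (beq x a) = preds a"
  by (simp add: beq_def)

lemma eval_conjs [simp]: "eval M I \<rho> (conjs as) \<longleftrightarrow> (\<forall>a\<in>set as. eval M I \<rho> a)"
  by (induction as) (simp_all add: conjs_def)


section \<open>Programs and formulas over a set of predicate symbols\<close>

text \<open>Unlike \<open>program\<close>, this admits symbols of \<open>U\<close> in every
  component and any formula as initial condition. Only so does it survive the translation:
  \<open>split_state\<close> puts auxiliary predicates into formulas, and eliminating temporal
  operators carries them on into transitions and fairness conditions.\<close>

definition prog_over :: "psym set \<Rightarrow> ('f, 'r) prog \<Rightarrow> bool" where
  "prog_over U D \<longleftrightarrow>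
     distinct (vars D) \<and> fv (init D) \<subseteq> set (vars D) \<and>
     fv (nxt D) \<subseteq> set (vars D) \<times> {0, 1} \<and> (\<forall>c\<in>set (fair D). fv c \<subseteq> set (vars D)) \<and>
     preds_prog D \<subseteq> U"

definition fm_over :: "nat list \<Rightarrow> psym set \<Rightarrow> ('f, 'r, nat) fm ctl \<Rightarrow> bool" where
  "fm_over v U \<phi> \<longleftrightarrow> (\<forall>c\<in>assertions \<phi>. fv c \<subseteq> set v \<and> preds c \<subseteq> U)"

lemma prog_over_mono: "prog_over U D \<Longrightarrow> U \<subseteq> U' \<Longrightarrow> prog_over U' D"
  by (auto simp: prog_over_def)

lemma fm_over_mono: "fm_over v U \<phi> \<Longrightarrow> set v \<subseteq> set v' \<Longrightarrow> U \<subseteq> U' \<Longrightarrow> fm_over v' U' \<phi>"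
  unfolding fm_over_def by blast

section \<open>Dependence on the program variables and the symbols in use\<close>

lemma step_cong:
  assumes "prog_over U D" "agree U I I'" "agree (set (vars D)) s1 s2" "agree (set (vars D)) s1' s2'"
  shows "step M I D s1 s1' = step M I' D s2 s2'"
  unfolding step_def using assms
  by (intro eval_cong) (force simp: agree_def prog_over_def preds_prog_def)+

lemma eval_nxt:
  assumes "prog_over U D"
  shows "eval M I \<rho> (nxt D) \<longleftrightarrow> step M I D (\<lambda>x. \<rho> (x, 0)) (\<lambda>x. \<rho> (x, 1))"
  unfolding step_def using assms
  by (intro eval_cong) (force simp: agree_def prog_over_def)+

lemma eval_fair_cong:
  assumes "prog_over U D" "agree U I I'" "agree (set (vars D)) s s'" "c \<in> set (fair D)"
  shows "eval M I s c = eval M I' s' c"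
  using assms by (intro eval_cong) (force simp: agree_def prog_over_def preds_prog_def)+

lemma eval_init_cong:
  assumes "prog_over U D" "agree U I I'" "agree (set (vars D)) s s'"
  shows "eval M I s (init D) = eval M I' s' (init D)"
  using assms by (intro eval_cong) (force simp: agree_def prog_over_def preds_prog_def)+

lemma prog_path_cong:
  assumes "prog_over U D" "agree U I I'" "\<And>i. agree (set (vars D)) (\<pi> i) (\<pi>' i)"
  shows "prog_path M I D \<pi> = prog_path M I' D \<pi>'"
  unfolding prog_path_def using step_cong[OF assms(1,2,3,3)] by simp

lemma fair_path_cong:
  assumes "prog_over U D" "agree U I I'" "\<And>i. agree (set (vars D)) (\<pi> i) (\<pi>' i)"
  shows "fair_path M I D \<pi> = fair_path M I' D \<pi>'"
proof -
  have "{i. eval M I (\<pi> i) c} = {i. eval M I' (\<pi>' i) c}" if "c \<in> set (fair D)" for c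
    using eval_fair_cong[OF assms(1,2,3) that] by auto
  then show ?thesis
    using prog_path_cong[OF assms] by (simp add: fair_path_def)
qed

text \<open>It is enough to overwrite the first state of a path by the required one: the two states
  agree on \<open>V\<close>, and the properties \<open>Q\<close> and \<open>Q'\<close> cannot tell
  such paths apart.\<close>

lemma ex_path_cong:
  assumes "agree V s s'"
    and "\<And>\<sigma> \<sigma>'. (\<And>i. agree V (\<sigma> i) (\<sigma>' i)) \<Longrightarrow> Q \<sigma> = Q' \<sigma>'"
  shows "(\<exists>\<sigma>. Q \<sigma> \<and> \<sigma> 0 = s) \<longleftrightarrow> (\<exists>\<sigma>. Q' \<sigma> \<and> \<sigma> (0::nat) = s')"
proof (intro iffI; elim exE conjE)
  fix \<sigma> assume \<sigma>: "Q \<sigma>" "\<sigma> 0 = s"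
  then have "Q \<sigma> = Q' (\<sigma>(0 := s'))" using assms(1) by (intro assms(2)) simp
  then show "\<exists>\<sigma>. Q' \<sigma> \<and> \<sigma> 0 = s'" using \<sigma>
    by (intro exI[of _ "\<sigma>(0 := s')"]) simp
next
  fix \<sigma> assume \<sigma>: "Q' \<sigma>" "\<sigma> 0 = s'"
  then have "Q (\<sigma>(0 := s)) = Q' \<sigma>" using assms(1) by (intro assms(2)) simp
  then show "\<exists>\<sigma>. Q \<sigma> \<and> \<sigma> 0 = s" using \<sigma>
    by (intro exI[of _ "\<sigma>(0 := s)"]) simp
qed

lemma all_path_cong:
  assumes "agree V s s'"
    and "\<And>\<sigma> \<sigma>'. (\<And>i. agree V (\<sigma> i) (\<sigma>' i)) \<Longrightarrow> Q \<sigma> = Q' \<sigma>'"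
  shows "(\<forall>\<sigma>. \<sigma> 0 = s \<longrightarrow> Q \<sigma>) \<longleftrightarrow> (\<forall>\<sigma>. \<sigma> (0::nat) = s' \<longrightarrow> Q' \<sigma>)"
  using ex_path_cong[of V s s' "\<lambda>\<sigma>. \<not> Q \<sigma>" "\<lambda>\<sigma>. \<not> Q' \<sigma>"] assms by metis

lemma sat_cong:
  assumes D: "prog_over U D" and I: "agree U I I'"
  shows "fm_over (vars D) U \<phi> \<Longrightarrow> (\<And>i. agree (set (vars D)) (\<pi> i) (\<pi>' i)) \<Longrightarrow>
    sat M I D \<pi> \<phi> = sat M I' D \<pi>' \<phi>"
proof (induction \<phi> arbitrary: \<pi> \<pi>')
  case (Asn c)
  then have "eval M I (\<pi> 0) c = eval M I' (\<pi>' 0) c"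
    using I by (intro eval_cong) (auto simp: fm_over_def intro: agree_mono)
  then show ?case by simp
next
  case (Conj \<phi> \<psi>)
  then have "sat M I D \<pi> \<phi> = sat M I' D \<pi>' \<phi>" "sat M I D \<pi> \<psi> = sat M I' D \<pi>' \<psi>"
    by (auto simp: fm_over_def)
  then show ?case by simp
next
  case (Disj \<phi> \<psi>)
  then have "sat M I D \<pi> \<phi> = sat M I' D \<pi>' \<phi>" "sat M I D \<pi> \<psi> = sat M I' D \<pi>' \<psi>"
    by (auto simp: fm_over_def)
  then show ?case by simp
next
  case (Nxt \<psi>)
  then have "sat M I D (seq_suffix 1 \<pi>) \<psi> = sat M I' D (seq_suffix 1 \<pi>') \<psi>"
    by (intro Nxt.IH) (auto simp: fm_over_def seq_suffix_def)
  then show ?case by simp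
next
  case (Alw \<psi>)
  then have "sat M I D (seq_suffix i \<pi>) \<psi> = sat M I' D (seq_suffix i \<pi>') \<psi>" for i
    by (intro Alw.IH) (auto simp: fm_over_def seq_suffix_def)
  then show ?case by simp
next
  case (Unt \<psi> \<chi>)
  have "sat M I D (seq_suffix i \<pi>) \<psi> = sat M I' D (seq_suffix i \<pi>') \<psi>" for i
    using Unt.prems by (intro Unt.IH(1)) (auto simp: fm_over_def seq_suffix_def)
  moreover have "sat M I D (seq_suffix i \<pi>) \<chi> = sat M I' D (seq_suffix i \<pi>') \<chi>" for i
    using Unt.prems by (intro Unt.IH(2)) (auto simp: fm_over_def seq_suffix_def)
  ultimately show ?case by simp
next
  case (Qu q \<psi>)
  have s: "sat M I D \<sigma> \<psi> = sat M I' D \<sigma>' \<psi>"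
    if "\<And>i. agree (set (vars D)) (\<sigma> i) (\<sigma>' i)" for \<sigma> \<sigma>'
    using Qu that by (auto simp: fm_over_def)
  have p: "prog_path M I D \<sigma> = prog_path M I' D \<sigma>'" "fair_path M I D \<sigma> = fair_path M I' D \<sigma>'"
    if "\<And>i. agree (set (vars D)) (\<sigma> i) (\<sigma>' i)" for \<sigma> \<sigma>'
    using prog_path_cong[OF D I that] fair_path_cong[OF D I that] by auto
  note a = Qu.prems(2)[of 0]
  show ?case
  proof (cases q)
    case QA
    show ?thesis
      using all_path_cong[OF a, of "\<lambda>\<sigma>. prog_path M I D \<sigma> \<longrightarrow> sat M I D \<sigma> \<psi>"
          "\<lambda>\<sigma>. prog_path M I' D \<sigma> \<longrightarrow> sat M I' D \<sigma> \<psi>"] s p QA by (auto; metis)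
  next
    case QE
    show ?thesis
      using ex_path_cong[OF a, of "\<lambda>\<sigma>. prog_path M I D \<sigma> \<and> sat M I D \<sigma> \<psi>"
          "\<lambda>\<sigma>. prog_path M I' D \<sigma> \<and> sat M I' D \<sigma> \<psi>"] s p QE by (auto; metis)
  next
    case QAf
    show ?thesis
      using all_path_cong[OF a, of "\<lambda>\<sigma>. fair_path M I D \<sigma> \<longrightarrow> sat M I D \<sigma> \<psi>"
          "\<lambda>\<sigma>. fair_path M I' D \<sigma> \<longrightarrow> sat M I' D \<sigma> \<psi>"] s p QAf by (auto; metis)
  next
    case QEf
    show ?thesis
      using ex_path_cong[OF a, of "\<lambda>\<sigma>. fair_path M I D \<sigma> \<and> sat M I D \<sigma> \<psi>"
          "\<lambda>\<sigma>. fair_path M I' D \<sigma> \<and> sat M I' D \<sigma> \<psi>"] s p QEf by (auto; metis)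
  qed
qed

text \<open>The program enters \<open>sat\<close> only at path quantifiers.\<close>

lemma sat_quantifier_free: "quantifier_free \<psi> \<Longrightarrow> sat M I D \<pi> \<psi> = sat M I D' \<pi> \<psi>"
  by (induction \<psi> arbitrary: \<pi>) auto

lemma fair_path_no_fairness: "fair_path M I (D\<lparr>fair := []\<rparr>) \<pi> = prog_path M I D \<pi>"
  by (simp add: fair_path_def prog_path_def step_def)

lemma step_init [simp]: "step M I (D\<lparr>init := a\<rparr>) = step M I D"
  by (simp add: step_def fun_eq_iff)

lemma prog_path_init [simp]: "prog_path M I (D\<lparr>init := a\<rparr>) = prog_path M I D"
  by (simp add: prog_path_def fun_eq_iff)

lemma fair_path_init [simp]: "fair_path M I (D\<lparr>init := a\<rparr>) = fair_path M I D"
  by (simp add: fair_path_def fun_eq_iff)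

lemma sat_init [simp]: "sat M I (D\<lparr>init := a\<rparr>) \<pi> \<phi> = sat M I D \<pi> \<phi>"
  by (induction \<phi> arbitrary: \<pi>) (simp_all split: quant.split)

lemma sat_as_assertion: "as_assertion \<psi> = Some c \<Longrightarrow> sat M I D \<pi> \<psi> = eval M I (\<pi> 0) c"
  by (induction \<psi> arbitrary: c rule: as_assertion.induct) (auto split: option.splits)

lemma fm_over_as_assertion:
  "as_assertion \<psi> = Some c \<Longrightarrow> fm_over v U \<psi> \<Longrightarrow> fv c \<subseteq> set v \<and> preds c \<subseteq> U"
proof (induction \<psi> arbitrary: c rule: as_assertion.induct)
  case (2 \<phi> \<psi>)
  then obtain d e where "as_assertion \<phi> = Some d" "as_assertion \<psi> = Some e" "c = And d e"
    by (auto split: option.splits)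
  with 2 show ?case by (auto simp: fm_over_def)
next
  case (3 \<phi> \<psi>)
  then obtain d e where "as_assertion \<phi> = Some d" "as_assertion \<psi> = Some e" "c = Or d e"
    by (auto split: option.splits)
  with 3 show ?case by (auto simp: fm_over_def)
qed (auto simp: fm_over_def)


section \<open>Replacement of subformulas\<close>

lemma replace1_assertions: "replace1 \<phi> \<gamma> \<psi> \<psi>' \<Longrightarrow> assertions \<psi>' \<subseteq> assertions \<psi> \<union> assertions \<gamma>"
  by (induction rule: replace1.induct) auto

lemma replace1_subformula: "replace1 \<phi> \<gamma> \<psi> \<psi>' \<Longrightarrow> assertions \<phi> \<subseteq> assertions \<psi>"
  by (induction rule: replace1.induct) auto

lemma replaces_fm_over:
  assumes "replaces \<phi> \<gamma> \<psi> \<psi>'" "fm_over v U \<psi>" "fm_over v U \<gamma>"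
  shows "fm_over v U \<psi>'"
  using assms(1) unfolding replaces_def
  by (induction rule: tranclp_induct)
    (use assms(2,3) in \<open>force dest: replace1_assertions simp: fm_over_def\<close>)+

lemma replaces_fm_over_subformula:
  assumes "replaces \<phi> \<gamma> \<psi> \<psi>'" "fm_over v U \<psi>"
  shows "fm_over v U \<phi>"
proof -
  obtain \<chi> where "replace1 \<phi> \<gamma> \<psi> \<chi>"
    using assms(1) unfolding replaces_def by (meson tranclpD)
  then show ?thesis using assms(2) replace1_subformula by (fastforce simp: fm_over_def)
qed

text \<open>Equivalence is assumed on all sequences because a path quantifier around the occurrence
  moves on to an arbitrary path.\<close>

lemma replace1_sat:
  assumes "\<And>\<pi>. sat M I D \<pi> \<phi> = sat M I D \<pi> \<gamma>"
  shows "replace1 \<phi> \<gamma> \<psi> \<psi>' \<Longrightarrow> sat M I D \<pi> \<psi> = sat M I D \<pi> \<psi>'"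
  by (induction arbitrary: \<pi> rule: replace1.induct) (simp_all add: assms split: quant.split)

lemma replaces_sat:
  assumes "\<And>\<pi>. sat M I D \<pi> \<phi> = sat M I D \<pi> \<gamma>" "replaces \<phi> \<gamma> \<psi> \<psi>'"
  shows "sat M I D \<pi> \<psi> = sat M I D \<pi> \<psi>'"
  using assms(2) unfolding replaces_def
  by (induction rule: tranclp_induct) (simp_all add: replace1_sat[OF assms(1)])

lemma seq_suffix_seq_suffix [simp]: "seq_suffix i (seq_suffix j \<pi>) = seq_suffix (j + i) \<pi>"
  by (simp add: seq_suffix_def add.assoc)

lemma seq_suffix_0 [simp]: "seq_suffix 0 \<pi> = \<pi>"
  by (simp add: seq_suffix_def)

lemma seq_suffix_apply [simp]: "seq_suffix i \<pi> j = \<pi> (i + j)"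
  by (simp add: seq_suffix_def)

lemma replace1_quantifier_free:
  "replace1 \<phi> \<gamma> \<psi> \<psi>' \<Longrightarrow> quantifier_free \<psi> \<Longrightarrow> quantifier_free \<gamma> \<Longrightarrow> quantifier_free \<psi>'"
  by (induction rule: replace1.induct) auto

text \<open>Without path quantifiers, evaluation never leaves the suffixes of \<open>\<pi>\<close>,
  so equivalence is demanded only there. This is the form that fits a boolean variable, whose value
  is known to be right along one fair path.\<close>

lemma replace1_sat_path:
  "replace1 \<phi> \<gamma> \<psi> \<psi>' \<Longrightarrow> quantifier_free \<psi> \<Longrightarrow>
   (\<And>i. sat M I D (seq_suffix i \<pi>) \<phi> = sat M I D (seq_suffix i \<pi>) \<gamma>) \<Longrightarrow>
   sat M I D \<pi> \<psi> = sat M I D \<pi> \<psi>'"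
proof (induction arbitrary: \<pi> rule: replace1.induct)
  case here
  show ?case using here(2)[of 0] by simp
qed simp_all

lemma replaces_sat_path:
  assumes "replaces \<phi> \<gamma> \<psi> \<psi>'" "quantifier_free \<psi>" "quantifier_free \<gamma>"
    and "\<And>i. sat M I D (seq_suffix i \<pi>) \<phi> = sat M I D (seq_suffix i \<pi>) \<gamma>"
  shows "sat M I D \<pi> \<psi> = sat M I D \<pi> \<psi>'"
proof -
  \<comment> \<open>Each single replacement requires a quantifier-free source, so this property is
    carried along the chain.\<close>
  have "sat M I D \<pi> \<psi> = sat M I D \<pi> \<psi>' \<and> quantifier_free \<psi>'"
    using assms(1) unfolding replaces_def
  proof (induction rule: tranclp_induct)
    case (base \<chi>)
    then show ?case
      using replace1_sat_path[OF base assms(2,4)] replace1_quantifier_free[OF base assms(2,3)]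
      by blast
  next
    case (step \<chi> \<chi>')
    then show ?case
      using replace1_sat_path[OF step(2) _ assms(4)] replace1_quantifier_free[OF step(2) _ assms(3)]
      by blast
  qed
  then show ?thesis by simp
qed


section \<open>Eliminating temporal operators\<close>

text \<open>The recurrence alone also admits the solution that is false throughout. Fairness
  excludes it: if \<open>c\<close> held from \<open>i\<close> on with \<open>b i\<close> false, then
  \<open>b\<close> would stay false from \<open>i\<close> on, and neither disjunct of the fairness
  condition could recur.\<close>

lemma always_unfold:
  fixes b c :: "nat \<Rightarrow> bool"
  assumes rec: "\<And>i. b i \<longleftrightarrow> c i \<and> b (Suc i)" and inf: "infinite {i. b i \<or> \<not> c i}"
  shows "b i \<longleftrightarrow> (\<forall>j. c (i + j))"
proof
  assume "b i"
  then have "b (i + j)" for j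
    by (induction j) (simp, metis rec add_Suc_right)
  then show "\<forall>j. c (i + j)" using rec by blast
next
  assume c: "\<forall>j. c (i + j)"
  show "b i"
  proof (rule ccontr)
    assume "\<not> b i"
    then have b: "\<not> b (i + j)" for j
      by (induction j) (simp, metis rec c add_Suc_right)
    obtain n where "n \<ge> i" "b n \<or> \<not> c n"
      using inf by (auto simp: infinite_nat_iff_unbounded_le)
    then show False using b[of "n - i"] c by (auto dest: spec[of _ "n - i"])
  qed
qed

text \<open>Here the spurious solution is \<open>b\<close> true forever while \<open>c2\<close>
  never comes. If the until formula failed at \<open>i\<close> with \<open>b i\<close> true, the
  recurrence would keep \<open>b\<close> true and \<open>c2\<close> false from \<open>i\<close> on,
  against fairness.\<close>

lemma until_unfold:
  fixes b c1 c2 :: "nat \<Rightarrow> bool"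
  assumes rec: "\<And>i. b i \<longleftrightarrow> c2 i \<or> c1 i \<and> b (Suc i)" and inf: "infinite {i. \<not> b i \<or> c2 i}"
  shows "b i \<longleftrightarrow> (\<exists>j. c2 (i + j) \<and> (\<forall>k<j. c1 (i + k)))"
proof
  assume bi: "b i"
  show "\<exists>j. c2 (i + j) \<and> (\<forall>k<j. c1 (i + k))"
  proof (rule ccontr)
    assume no: "\<not> ?thesis"
    have b: "b (i + j) \<and> (\<forall>k<j. c1 (i + k))" for j
    proof (induction j)
      case 0
      then show ?case using bi by simp
    next
      case (Suc j)
      then have "\<not> c2 (i + j)" using no by blast
      then show ?case using Suc rec[of "i + j"] by (auto simp: less_Suc_eq)
    qed
    obtain n where "n \<ge> i" "\<not> b n \<or> c2 n"
      using inf by (auto simp: infinite_nat_iff_unbounded_le)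
    then show False using b[of "n - i"] no by (auto dest: spec[of _ "n - i"])
  qed
next
  assume "\<exists>j. c2 (i + j) \<and> (\<forall>k<j. c1 (i + k))"
  then obtain j where "c2 (i + j)" "\<forall>k<j. c1 (i + k)" by blast
  then show "b i"
  proof (induction j arbitrary: i)
    case 0
    then show ?case using rec[of i] by simp
  next
    case (Suc j)
    have "c1 i" using Suc.prems(2) by force
    moreover have "b (Suc i)"
    proof (rule Suc.IH)
      show "\<forall>k<j. c1 (Suc i + k)"
        using Suc.prems(2) by (metis Suc_less_eq add_Suc add_Suc_right)
    qed (use Suc.prems in simp)
    ultimately show ?case using rec[of i] by simp
  qed
qed

text \<open>For every \<open>m\<close> some position from \<open>m\<close> on qualifies:
  \<open>m\<close> itself if \<open>c\<close> holds from there on, otherwise a position where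
  \<open>c\<close> fails.\<close>

lemma infinite_always: "infinite {i. (\<forall>j. c (i + j)) \<or> \<not> c (i :: nat)}"
  unfolding infinite_nat_iff_unbounded_le
proof
  fix m
  show "\<exists>n\<ge>m. n \<in> {i. (\<forall>j. c (i + j)) \<or> \<not> c i}"
    using le_add1[of m] by (cases "\<forall>j. c (m + j)") blast+
qed

text \<open>If \<open>c2\<close> holds somewhere from \<open>m\<close> on, that position qualifies;
  otherwise the until formula fails at \<open>m\<close>, and \<open>m\<close> qualifies.\<close>

lemma infinite_until:
  "infinite {i. \<not> (\<exists>j. c2 (i + j) \<and> (\<forall>k<j. c1 (i + k))) \<or> c2 (i :: nat)}"
  unfolding infinite_nat_iff_unbounded_le
proof
  fix m
  show "\<exists>n\<ge>m. n \<in> {i. \<not> (\<exists>j. c2 (i + j) \<and> (\<forall>k<j. c1 (i + k))) \<or> c2 i}"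
    using le_add1[of m] by (cases "\<exists>j. c2 (m + j)") blast+
qed

lemma infinite_shift:
  assumes "infinite {i. P i}"
  shows "infinite {i. P (k + i :: nat)}"
  unfolding infinite_nat_iff_unbounded_le
proof
  fix m
  obtain n where "n \<ge> k + m" "P n"
    using assms by (auto simp: infinite_nat_iff_unbounded_le)
  then show "\<exists>n\<ge>m. n \<in> {i. P (k + i)}" by (intro exI[of _ "n - k"]) auto
qed

lemma fair_path_suffix: "fair_path M I D \<pi> \<Longrightarrow> fair_path M I D (seq_suffix k \<pi>)"
  using infinite_shift[of "\<lambda>i. eval M I (\<pi> i) c" k for c]
  by (simp add: fair_path_def prog_path_def)

section \<open>Programs extended by a boolean variable\<close>

lemma vars_extend_prog [simp]: "vars (extend_prog D x a js) = vars D @ [x]"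
  by (simp add: extend_prog_def)

lemma init_extend_prog [simp]: "init (extend_prog D x a js) = init D"
  by (simp add: extend_prog_def)

lemma fair_extend_prog [simp]: "fair (extend_prog D x a js) = fair D @ js"
  by (simp add: extend_prog_def)

lemma step_extend_prog [simp]:
  "step M I (extend_prog D x a js) s s' \<longleftrightarrow>
     step M I D s s' \<and> eval M I (\<lambda>(y, i). if i = 0 then s y else s' y) a"
  by (simp add: step_def extend_prog_def)

lemma fair_path_extend_progD: "fair_path M I (extend_prog D x a js) \<pi> \<Longrightarrow> fair_path M I D \<pi>"
  by (auto simp: fair_path_def prog_path_def)

lemma elim_temporal_fresh: "elim_temporal v x \<theta> a js \<Longrightarrow> x \<notin> set v"
  by (auto elim: elim_temporal.cases)

text \<open>The conjunct \<open>a\<close> gives an equation for \<open>x\<close> at every position.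
  For X it determines the value outright; for G and U, \<open>always_unfold\<close> and
  \<open>until_unfold\<close> apply, with the conditions \<open>js\<close> supplying the fairness.
  As \<open>\<theta>\<close> contains no path quantifier, its truth is the same in every program
  \<open>D'\<close>.\<close>

lemma elim_temporal_sat:
  assumes el: "elim_temporal v x \<theta> a js" and tf: "true_of M \<noteq> false_of M"
    and fp: "fair_path M I (extend_prog D x a js) \<pi>"
  shows "sat M I D' (seq_suffix i \<pi>) \<theta> \<longleftrightarrow> \<pi> i x = true_of M"
proof -
  from fp have st: "eval M I (\<lambda>(y, j). if j = 0 then \<pi> i y else \<pi> (Suc i) y) a" for i
    by (simp add: fair_path_def prog_path_def)
  from fp have fr: "infinite {i. eval M I (\<pi> i) j}" if "j \<in> set js" for j
    using that by (simp add: fair_path_def)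
  from el show ?thesis
  proof cases
    case (elim_X \<psi> c)
    with st[of i] tf show ?thesis by (simp add: sat_as_assertion)
  next
    case (elim_G \<psi> c)
    have "(\<pi> i x = true_of M) = (eval M I (\<pi> i) c \<and> \<pi> (Suc i) x = true_of M)" for i
      using st[of i] tf by (simp add: elim_G)
    from always_unfold[where b = "\<lambda>i. \<pi> i x = true_of M" and c = "\<lambda>i. eval M I (\<pi> i) c",
        OF this, of i] fr show ?thesis
      by (simp add: elim_G sat_as_assertion)
  next
    case (elim_U \<psi>1 c1 \<psi>2 c2)
    have "(\<pi> i x = true_of M) =
        (eval M I (\<pi> i) c2 \<or> eval M I (\<pi> i) c1 \<and> \<pi> (Suc i) x = true_of M)" for i
      using st[of i] tf by (simp add: elim_U)
    from until_unfold[where b = "\<lambda>i. \<pi> i x = true_of M" and ?c1.0 = "\<lambda>i. eval M I (\<pi> i) c1"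
        and ?c2.0 = "\<lambda>i. eval M I (\<pi> i) c2", OF this, of i] fr show ?thesis
      by (simp add: elim_U sat_as_assertion)
  qed
qed

lemma eval_upd_fresh: "x \<notin> fv c \<Longrightarrow> eval M I (s(x := e)) c = eval M I s c"
  by (rule eval_cong) (auto simp: agree_def)

text \<open>This is the converse: a fair path of \<open>D\<close> is labelled at each position with
  the truth value of \<open>\<theta>\<close> there. The recurrences hold since the temporal
  operators obey their unfolding laws, the new fairness conditions by \<open>infinite_always\<close>
  and \<open>infinite_until\<close>, and \<open>D\<close> does not see the fresh
  \<open>x\<close>.\<close>

lemma elim_temporal_path:
  fixes \<pi> :: "nat \<Rightarrow> 'e state"
  assumes el: "elim_temporal (vars D) x \<theta> a js" and tf: "true_of M \<noteq> false_of M"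
    and D: "prog_over U D" and \<theta>: "fm_over (vars D) U \<theta>" and fp: "fair_path M I D \<pi>"
  defines "b \<equiv> (\<lambda>i. if sat M I D (seq_suffix i \<pi>) \<theta> then true_of M else false_of M)"
  shows "fair_path M I (extend_prog D x a js) (\<lambda>i. (\<pi> i)(x := b i))" (is "fair_path M I _ ?\<pi>")
proof -
  have x: "x \<notin> set (vars D)" using el by (rule elim_temporal_fresh)
  have "fair_path M I D ?\<pi> = fair_path M I D \<pi>"
    using x by (intro fair_path_cong[OF D]) (auto simp: agree_def)
  with fp have fp': "fair_path M I D ?\<pi>" by simp
  have b: "b i = true_of M \<longleftrightarrow> sat M I D (seq_suffix i \<pi>) \<theta>" for i
    using tf by (simp add: b_def)
  have "(\<forall>i. eval M I (\<lambda>(y, j). if j = 0 then ?\<pi> i y else ?\<pi> (Suc i) y) a) \<and>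
      (\<forall>j\<in>set js. infinite {i. eval M I (?\<pi> i) j})"
    using el
  proof cases
    case (elim_X \<psi> c)
    have "fv c \<subseteq> set (vars D)"
      using \<theta> fm_over_as_assertion[of \<psi> c "vars D" U] elim_X by (simp add: fm_over_def)
    then have "x \<notin> fv c" using x by blast
    then have c: "eval M I ((\<pi> i)(x := e)) c = eval M I (\<pi> i) c" for i e
      by (rule eval_upd_fresh)
    have "b i = (if eval M I (\<pi> (Suc i)) c then true_of M else false_of M)" for i
      by (simp add: elim_X b_def sat_as_assertion)
    then show ?thesis
      by (simp add: elim_X c c[unfolded fun_upd_def])
  next
    case (elim_G \<psi> c)
    have "fv c \<subseteq> set (vars D)"
      using \<theta> fm_over_as_assertion[of \<psi> c "vars D" U] elim_G by (simp add: fm_over_def)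
    then have "x \<notin> fv c" using x by blast
    then have c: "eval M I ((\<pi> i)(x := e)) c = eval M I (\<pi> i) c" for i e
      by (rule eval_upd_fresh)
    define G where "G i \<longleftrightarrow> (\<forall>j. eval M I (\<pi> (i + j)) c)" for i
    have s: "sat M I D (seq_suffix i \<pi>) \<theta> = G i" for i
      by (simp add: elim_G sat_as_assertion G_def)
    have G: "G i \<longleftrightarrow> eval M I (\<pi> i) c \<and> G (Suc i)" for i
      unfolding G_def by (metis add_0_right add_Suc add_Suc_right not0_implies_Suc)
    have inf: "infinite {i. b i = true_of M \<or> \<not> eval M I (\<pi> i) c}"
      unfolding b s G_def by (rule infinite_always)
    have rec:
      "b i = (if eval M I (\<pi> i) c \<and> b (Suc i) = true_of M then true_of M else false_of M)" for i
      unfolding b s using G[of i] by (simp add: b_def s)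
    show ?thesis
    proof (intro conjI allI ballI)
      fix i show "eval M I (\<lambda>(y, j). if j = 0 then ?\<pi> i y else ?\<pi> (Suc i) y) a"
        using rec[of i] by (simp add: elim_G c c[unfolded fun_upd_def])
    next
      fix j assume "j \<in> set js"
      then show "infinite {i. eval M I (?\<pi> i) j}"
        using inf by (simp add: elim_G c)
    qed
  next
    case (elim_U \<psi>1 c1 \<psi>2 c2)
    have "fv c1 \<subseteq> set (vars D)" "fv c2 \<subseteq> set (vars D)"
      using \<theta> fm_over_as_assertion[of \<psi>1 c1 "vars D" U] fm_over_as_assertion[of \<psi>2 c2 "vars D" U]
        elim_U by (simp_all add: fm_over_def)
    then have "x \<notin> fv c1" "x \<notin> fv c2" using x by auto
    then have c: "eval M I ((\<pi> i)(x := e)) c1 = eval M I (\<pi> i) c1"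
        "eval M I ((\<pi> i)(x := e)) c2 = eval M I (\<pi> i) c2" for i e
      by (simp_all only: eval_upd_fresh not_False_eq_True)
    define G where "G i \<longleftrightarrow> (\<exists>j. eval M I (\<pi> (i + j)) c2 \<and> (\<forall>k<j. eval M I (\<pi> (i + k)) c1))" for i
    have s: "sat M I D (seq_suffix i \<pi>) \<theta> = G i" for i
      by (simp add: elim_U sat_as_assertion G_def)
    have G: "G i \<longleftrightarrow> eval M I (\<pi> i) c2 \<or> eval M I (\<pi> i) c1 \<and> G (Suc i)" for i
    proof -
      have "(\<exists>j. P j) \<longleftrightarrow> P 0 \<or> (\<exists>j. P (Suc j))" for P :: "nat \<Rightarrow> bool"
        by (metis not0_implies_Suc)
      from this[of "\<lambda>j. eval M I (\<pi> (i + j)) c2 \<and> (\<forall>k<j. eval M I (\<pi> (i + k)) c1)"]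
      show ?thesis by (simp add: G_def All_less_Suc2) blast
    qed
    have inf: "infinite {i. b i \<noteq> true_of M \<or> eval M I (\<pi> i) c2}"
      unfolding b s G_def by (rule infinite_until)
    have rec:
      "b i = (if eval M I (\<pi> i) c2 \<or> eval M I (\<pi> i) c1 \<and> b (Suc i) = true_of M
        then true_of M else false_of M)" for i
      unfolding b s using G[of i] by (simp add: b_def s)
    show ?thesis
    proof (intro conjI allI ballI)
      fix i show "eval M I (\<lambda>(y, j). if j = 0 then ?\<pi> i y else ?\<pi> (Suc i) y) a"
        using rec[of i] by (simp add: elim_U c c[unfolded fun_upd_def])
    next
      fix j assume "j \<in> set js"
      then show "infinite {i. eval M I (?\<pi> i) j}"
        using inf by (simp add: elim_U c)
    qed
  qed
  with fp' show ?thesis by (auto simp: fair_path_def prog_path_def)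
qed

lemma elim_temporal_over:
  assumes "elim_temporal v x \<theta> a js" "fm_over v U \<theta>"
  shows "fv a \<subseteq> set (v @ [x]) \<times> {0, 1}" "preds a \<subseteq> U"
    "\<forall>j\<in>set js. fv j \<subseteq> set (v @ [x]) \<and> preds j \<subseteq> U"
proof -
  have "fv a \<subseteq> set (v @ [x]) \<times> {0, 1} \<and> preds a \<subseteq> U \<and>
      (\<forall>j\<in>set js. fv j \<subseteq> set (v @ [x]) \<and> preds j \<subseteq> U)"
    using assms(1)
  proof cases
    case (elim_X \<psi> c)
    then show ?thesis
      using assms(2) fm_over_as_assertion[of \<psi> c v U] by (auto simp: fm_over_def)
  next
    case (elim_G \<psi> c)
    then show ?thesis
      using assms(2) fm_over_as_assertion[of \<psi> c v U] by (auto simp: fm_over_def)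
  next
    case (elim_U \<psi>1 c1 \<psi>2 c2)
    moreover have "fm_over v U \<psi>1" "fm_over v U \<psi>2"
      using assms(2) elim_U by (auto simp: fm_over_def)
    ultimately show ?thesis
      using fm_over_as_assertion[of \<psi>1 c1 v U] fm_over_as_assertion[of \<psi>2 c2 v U]
      by auto
  qed
  then show "fv a \<subseteq> set (v @ [x]) \<times> {0, 1}" "preds a \<subseteq> U"
    "\<forall>j\<in>set js. fv j \<subseteq> set (v @ [x]) \<and> preds j \<subseteq> U" by blast+
qed

lemma extend_prog_over:
  assumes "elim_temporal (vars D) x \<theta> a js" "fm_over (vars D) U \<theta>" "prog_over U D"
  shows "prog_over U (extend_prog D x a js)"
  using assms(3) elim_temporal_over[OF assms(1,2)] elim_temporal_fresh[OF assms(1)]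
  unfolding prog_over_def extend_prog_def preds_prog_def
  by auto


section \<open>Tuples as states\<close>

text \<open>Names outside \<open>v\<close> receive an unspecified value, so a state is recovered
  from its tuple only up to agreement on \<open>v\<close>.\<close>

definition state_of :: "nat list \<Rightarrow> 'e list \<Rightarrow> 'e state" where
  "state_of v es = (\<lambda>x. the (map_of (zip v es) x))"

lemma agree_state_of: "agree (set v) (state_of v (map s v)) s"
  by (simp add: agree_def state_of_def map_of_zip_map)

definition tuples :: "nat list \<Rightarrow> ('e state \<Rightarrow> bool) \<Rightarrow> 'e list set" where
  "tuples v P = {es. length es = length v \<and> P (state_of v es)}"

text \<open>Going from \<open>s\<close> to its tuple and back may change \<open>s\<close> outside
  \<open>v\<close>; the hypothesis makes \<open>P\<close> blind to such a change.\<close>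

lemma map_in_tuples:
  assumes "\<And>s s'. agree (set v) s s' \<Longrightarrow> P s = P s'"
  shows "map s v \<in> tuples v P \<longleftrightarrow> P s"
  using assms[OF agree_state_of] by (simp add: tuples_def)

definition tuple_pairs :: "nat \<Rightarrow> ('e list \<Rightarrow> 'e list \<Rightarrow> bool) \<Rightarrow> 'e list set" where
  "tuple_pairs n R = {es @ es' |es es'. length es = n \<and> length es' = n \<and> R es es'}"

lemma append_in_tuple_pairs:
  "length es = n \<Longrightarrow> length es' = n \<Longrightarrow> es @ es' \<in> tuple_pairs n R \<longleftrightarrow> R es es'"
  by (auto simp: tuple_pairs_def)

lemma length_tuple_pairs: "tuple_pairs n R \<subseteq> {es. length es = 2 * n}"
  by (auto simp: tuple_pairs_def)

text \<open>\<open>pair_rel\<close> splits a list in the middle. For a list of length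
  \<open>2 * n\<close> this is the split after \<open>n\<close> entries, hence the one from which
  the list was built.\<close>

lemma pair_rel_tuple_pairs: "pair_rel (tuple_pairs n R) \<subseteq> {(es, es'). R es es'}"
proof -
  have "R es es'" if h: "length es = length es'" "es @ es' \<in> tuple_pairs n R" for es es'
  proof -
    obtain fs fs' where f: "es @ es' = fs @ fs'" "length fs = n" "length fs' = n" "R fs fs'"
      using h(2) by (auto simp: tuple_pairs_def)
    from arg_cong[OF f(1), of length] have "length es = n" using h(1) f(2,3) by simp
    with f show ?thesis by simp
  qed
  then show ?thesis by (auto simp: pair_rel_def)
qed

lemma disj_wf_tuple_pairs:
  assumes "wf {(es', es). R es es'}"
  shows "disj_wf ((pair_rel (tuple_pairs n R))\<inverse>)"
proof -
  have "(pair_rel (tuple_pairs n R))\<inverse> \<subseteq> {(es', es). R es es'}"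
    using pair_rel_tuple_pairs by fastforce
  with assms have "wf ((pair_rel (tuple_pairs n R))\<inverse>)" by (rule wf_subset)
  then show ?thesis unfolding disj_wf_def
    by (intro exI[of _ "\<lambda>_. (pair_rel (tuple_pairs n R))\<inverse>"] exI[of _ 1]) auto
qed


section \<open>Concatenating finite segments\<close>

lemma segment_index:
  fixes l :: "nat \<Rightarrow> nat"
  assumes "\<And>n. l n > 0"
  shows "\<exists>n j. j < l n \<and> m = (\<Sum>i<n. l i) + j"
proof (induction m)
  case 0
  show ?case using assms[of 0] by (intro exI[of _ 0]) simp
next
  case (Suc m)
  then obtain n j where j: "j < l n" "m = (\<Sum>i<n. l i) + j" by blast
  show ?case
  proof (cases "Suc j < l n")
    case True
    then show ?thesis using j by (intro exI[of _ n] exI[of _ "Suc j"]) simp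
  next
    case False
    then have "Suc m = (\<Sum>i<Suc n. l i) + 0" using j by simp
    then show ?thesis using assms[of "Suc n"] by blast
  qed
qed

lemma segment_index_unique:
  fixes l :: "nat \<Rightarrow> nat" and n n' :: nat
  assumes "j < l n" "j' < l n'" "(\<Sum>i<n. l i) + j = (\<Sum>i<n'. l i) + j'"
  shows "n = n' \<and> j = j'"
proof -
  have le: "(\<Sum>i<n. l i) + l n \<le> (\<Sum>i<n'. l i)" if "n < n'" for n n' :: nat
    using that sum_mono2[of "{..<n'}" "{..<Suc n}" l] by simp
  have "\<not> n < n'" "\<not> n' < n" using le[of n n'] le[of n' n] assms by linarith+
  with assms(3) show ?thesis by simp
qed

text \<open>Segment \<open>n\<close> owns the offsets below \<open>l n\<close>. Its endpoint is
  offset 0 of the next segment, which owns that offset because its length is positive;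
  \<open>glue\<close> makes the two readings of the point coincide.\<close>

lemma concat_segments:
  fixes l :: "nat \<Rightarrow> nat" and f :: "nat \<Rightarrow> nat \<Rightarrow> 'a"
  assumes pos: "\<And>n. l n > 0" and glue: "\<And>n. f n (l n) = f (Suc n) 0"
  shows "\<exists>\<sigma>. \<forall>n. \<forall>j\<le>l n. \<sigma> ((\<Sum>i<n. l i) + j) = f n j"
proof -
  define \<sigma> where "\<sigma> m = (THE y. \<exists>n j. j < l n \<and> m = (\<Sum>i<n. l i) + j \<and> y = f n j)" for m
  have \<sigma>: "\<sigma> ((\<Sum>i<n. l i) + j) = f n j" if "j < l n" for n j
    unfolding \<sigma>_def
  proof (rule the_equality)
    show "\<exists>n' j'. j' < l n' \<and> (\<Sum>i<n. l i) + j = (\<Sum>i<n'. l i) + j' \<and> f n j = f n' j'"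
      using that by blast
  next
    fix y assume "\<exists>n' j'. j' < l n' \<and> (\<Sum>i<n. l i) + j = (\<Sum>i<n'. l i) + j' \<and> y = f n' j'"
    then show "y = f n j" using segment_index_unique[of j l n] that by metis
  qed
  have "\<sigma> ((\<Sum>i<n. l i) + l n) = f n (l n)" for n
    using \<sigma>[of 0 "Suc n"] pos[of "Suc n"] glue[of n] by simp
  with \<sigma> show ?thesis by (metis le_neq_implies_less)
qed

lemma segments_path:
  fixes l :: "nat \<Rightarrow> nat"
  assumes pos: "\<And>n. l n > 0" and R: "\<And>n j. j < l n \<Longrightarrow> R (f n j) (f n (Suc j))"
    and \<sigma>: "\<forall>n. \<forall>j\<le>l n. \<sigma> ((\<Sum>i<n. l i) + j) = f n j"
  shows "R (\<sigma> m) (\<sigma> (Suc m))"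
proof -
  obtain n j where j: "j < l n" "m = (\<Sum>i<n. l i) + j"
    using segment_index[of l m] pos by blast
  have "\<sigma> m = f n j" using \<sigma>[rule_format, of j n] j by simp
  moreover have "\<sigma> (Suc m) = f n (Suc j)" using \<sigma>[rule_format, of "Suc j" n] j by simp
  ultimately show ?thesis using R j by simp
qed

lemma segment_start_ge:
  fixes l :: "nat \<Rightarrow> nat"
  assumes "\<And>n. l n > 0"
  shows "n \<le> (\<Sum>i<n. l i)"
proof (induction n)
  case (Suc n)
  then show ?case using assms[of n] by simp
qed simp

text \<open>Condition \<open>i\<close> is tested on arrival, at the end of step \<open>i\<close>
  counted from 0, and never at the starting point. This mirrors the clause for \<open>r\<close>,
  which tests each fairness condition at the later of two successive copies.\<close>

definition visits :: "('a \<Rightarrow> 'a \<Rightarrow> bool) \<Rightarrow> (nat \<Rightarrow> 'a \<Rightarrow> bool) \<Rightarrow> nat \<Rightarrow> 'a \<Rightarrow> 'a \<Rightarrow> bool" where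
  "visits R J k x y \<longleftrightarrow>
     (\<exists>f. f 0 = x \<and> f k = y \<and> (\<forall>i<k. R (f i) (f (Suc i)) \<and> J i (f (Suc i))))"

text \<open>Each link unfolds into a nonempty finite segment, and \<open>e n\<close> is the time at
  which \<open>h n\<close> is reached. The bound \<open>n \<le> e n\<close> serves to turn visits at
  unboundedly many indices of \<open>h\<close> into visits at unboundedly late times of
  \<open>\<sigma>\<close>.\<close>

lemma chain_tranclp_path:
  assumes "\<And>n. R\<^sup>+\<^sup>+ (h n) (h (Suc n))"
  obtains \<sigma> e where "\<And>m. R (\<sigma> m) (\<sigma> (Suc m))" "\<And>n. \<sigma> (e n) = h n" "\<And>n. n \<le> e n" "e 0 = (0::nat)"
proof -
  have "\<exists>l f. l > 0 \<and> f 0 = h n \<and> f l = h (Suc n) \<and> (\<forall>i<l. R (f i) (f (Suc i)))" for n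
    using assms[of n] by (auto simp: tranclp_power relpowp_fun_conv)
  then obtain l f where l: "\<And>n. l n > (0::nat)"
    and f: "\<And>n. f n 0 = h n" "\<And>n. f n (l n) = h (Suc n)" "\<And>n i. i < l n \<Longrightarrow> R (f n i) (f n (Suc i))"
    by metis
  obtain \<sigma> where \<sigma>: "\<forall>n. \<forall>j\<le>l n. \<sigma> ((\<Sum>i<n. l i) + j) = f n j"
    using concat_segments[of l f] l f by metis
  show thesis
  proof
    show "R (\<sigma> m) (\<sigma> (Suc m))" for m
      by (rule segments_path[of l R f \<sigma>]) (use l f(3) \<sigma> in auto)
    show "\<sigma> (\<Sum>i<n. l i) = h n" for n using \<sigma>[rule_format, of 0 n] f(1) by simp
    show "n \<le> (\<Sum>i<n. l i)" for n by (rule segment_start_ge) (rule l)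
    show "(\<Sum>i<0. l i) = 0" by simp
  qed
qed

text \<open>An infinite chain of rounds would be a chain of links of the transitive closure;
  refining the links to single steps of \<open>R\<close> would give a path that starts in
  \<open>P\<close> and meets every condition infinitely often.\<close>

lemma wf_visits:
  assumes k: "k > 0"
    and no: "\<not> (\<exists>\<sigma>. P (\<sigma> 0) \<and> (\<forall>i. R (\<sigma> i) (\<sigma> (Suc i))) \<and> (\<forall>j<k. infinite {i. J j (\<sigma> i)}))"
  shows "wf {(y, x). P x \<and> visits R\<^sup>+\<^sup>+ J k x y}"
  unfolding wf_iff_no_infinite_down_chain
proof
  assume "\<exists>g. \<forall>i. (g (Suc i), g i) \<in> {(y, x). P x \<and> visits R\<^sup>+\<^sup>+ J k x y}"
  then obtain g where P: "P (g 0)" and g: "\<And>n. visits R\<^sup>+\<^sup>+ J k (g n) (g (Suc n))" by auto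
  obtain f where f: "\<And>n. f n 0 = g n" "\<And>n. f n k = g (Suc n)"
    and fR: "\<And>n i. i < k \<Longrightarrow> R\<^sup>+\<^sup>+ (f n i) (f n (Suc i))"
    and fJ: "\<And>n i. i < k \<Longrightarrow> J i (f n (Suc i))"
    using g unfolding visits_def by metis
  obtain h where h: "\<forall>n. \<forall>j\<le>k. h ((\<Sum>i<n. k) + j) = f n j"
    using concat_segments[of "\<lambda>_. k" f] k f by metis
  have "R\<^sup>+\<^sup>+ (h m) (h (Suc m))" for m
    by (rule segments_path[of "\<lambda>_. k" "R\<^sup>+\<^sup>+" f h]) (use k fR h in auto)
  then obtain \<sigma> e where \<sigma>: "\<And>m. R (\<sigma> m) (\<sigma> (Suc m))" and e: "\<And>n. \<sigma> (e n) = h n" "\<And>n. n \<le> e n"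
      "e 0 = 0"
    using chain_tranclp_path[of R h] by blast
  have "P (\<sigma> 0)" using P f(1)[of 0] h[rule_format, of 0 0] e(1)[of 0] e(3) by simp
  moreover have "infinite {i. J j (\<sigma> i)}" if "j < k" for j
    unfolding infinite_nat_iff_unbounded_le
  proof
    fix m
    \<comment> \<open>Round \<open>m\<close> begins at index \<open>m * k\<close> of the joined
      chain and meets condition \<open>j\<close> at offset \<open>Suc j\<close>.\<close>
    have "J j (h (m * k + Suc j))" using fJ[OF that] h[rule_format, of "Suc j" m] that by simp
    moreover have "m \<le> e (m * k + Suc j)"
    proof -
      have "m * 1 \<le> m * k" using k by (intro mult_le_mono2) simp
      then show ?thesis using e(2)[of "m * k + Suc j"] by linarith
    qed
    ultimately show "\<exists>n\<ge>m. n \<in> {i. J j (\<sigma> i)}" using e(1) by (intro exI[of _ "e (m * k + Suc j)"]) simp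
  qed
  ultimately show False using no \<sigma> by blast
qed

text \<open>A finite prefix does not destroy infinitely many visits. It leads from a violating
  initial state, where a counterexample has to begin, to the reachable state where a chain of rounds
  begins.\<close>

lemma prepend_path:
  assumes "R\<^sup>*\<^sup>* x (\<sigma> 0)" "\<forall>i. R (\<sigma> i) (\<sigma> (Suc i))" "\<forall>j<k. infinite {i. J j (\<sigma> i)}"
  shows "\<exists>\<sigma>. \<sigma> 0 = x \<and> (\<forall>i. R (\<sigma> i) (\<sigma> (Suc i))) \<and> (\<forall>j<k. infinite {i. J j (\<sigma> (i::nat))})"
  using assms(1)
proof (induction rule: converse_rtranclp_induct)
  case base
  then show ?case using assms(2,3) by blast
next
  case (step x y)
  then obtain \<tau> where \<tau>: "\<tau> 0 = y" "\<forall>i. R (\<tau> i) (\<tau> (Suc i))" "\<forall>j<k. infinite {i. J j (\<tau> i)}"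
    by blast
  define \<tau>' where "\<tau>' = case_nat x \<tau>"
  have "infinite {i. J j (\<tau>' i)}" if "j < k" for j
  proof
    assume "finite {i. J j (\<tau>' i)}"
    moreover have "Suc ` {i. J j (\<tau> i)} \<subseteq> {i. J j (\<tau>' i)}" by (auto simp: \<tau>'_def)
    ultimately have "finite {i. J j (\<tau> i)}"
      by (meson finite_imageD finite_subset inj_Suc)
    then show False using \<tau>(3) that by blast
  qed
  moreover have "R (\<tau>' i) (\<tau>' (Suc i))" for i
    using \<tau>(1,2) step(1) by (cases i) (simp_all add: \<tau>'_def)
  moreover have "\<tau>' 0 = x" by (simp add: \<tau>'_def)
  ultimately show ?case by blast
qed


section \<open>Path formulas without temporal operators\<close>

definition tuple_step :: "('f, 'r, 'e) struct \<Rightarrow> 'e interp \<Rightarrow> ('f, 'r) prog \<Rightarrow> 'e list \<Rightarrow> 'e list \<Rightarrow> bool" where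
  "tuple_step M I D es es' \<longleftrightarrow> step M I D (state_of (vars D) es) (state_of (vars D) es')"

definition violating :: "('f, 'r, 'e) struct \<Rightarrow> 'e interp \<Rightarrow> ('f, 'r) prog \<Rightarrow> ('f, 'r, nat) fm \<Rightarrow> 'e list \<Rightarrow> bool" where
  "violating M I D c es \<longleftrightarrow>
     (\<exists>es0. eval M I (state_of (vars D) es0) (init D) \<and> \<not> eval M I (state_of (vars D) es0) c \<and>
       (tuple_step M I D)\<^sup>*\<^sup>* es0 es)"

text \<open>An index beyond the list counts as a condition that always holds. This supplies the one
  vacuous visit of a round in a program without fairness conditions.\<close>

definition fair_at :: "('f, 'r, 'e) struct \<Rightarrow> 'e interp \<Rightarrow> ('f, 'r) prog \<Rightarrow> nat \<Rightarrow> 'e list \<Rightarrow> bool" where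
  "fair_at M I D i es \<longleftrightarrow> (i < length (fair D) \<longrightarrow> eval M I (state_of (vars D) es) (fair D ! i))"

text \<open>
  Without fairness conditions, the maximum makes a round of visits a single transition of the
  transitive closure.
\<close>

definition fair_round :: "('f, 'r, 'e) struct \<Rightarrow> 'e interp \<Rightarrow> ('f, 'r) prog \<Rightarrow> ('f, 'r, nat) fm \<Rightarrow> 'e list \<Rightarrow> 'e list \<Rightarrow> bool" where
  "fair_round M I D c es es' \<longleftrightarrow> violating M I D c es \<and>
     visits (tuple_step M I D)\<^sup>+\<^sup>+ (fair_at M I D) (max 1 (length (fair D))) es es'"

text \<open>The chain to be excluded consists of tuples, since \<open>r\<close> is to be
  well-founded as a relation between tuples. Preceded by a prefix from a violating initial tuple and
  read through \<open>state_of\<close>, its refinement becomes a fair path that contradicts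
  \<open>no\<close>.\<close>

lemma wf_fair_round:
  assumes no: "\<And>\<pi>. fair_path M I D \<pi> \<Longrightarrow> eval M I (\<pi> 0) (init D) \<Longrightarrow> eval M I (\<pi> 0) c"
  shows "wf {(es', es). fair_round M I D c es es'}"
  unfolding fair_round_def
proof (rule wf_visits)
  let ?k = "max 1 (length (fair D))"
  show "\<not> (\<exists>\<sigma>. violating M I D c (\<sigma> 0) \<and> (\<forall>i. tuple_step M I D (\<sigma> i) (\<sigma> (Suc i))) \<and>
          (\<forall>j<?k. infinite {i. fair_at M I D j (\<sigma> i)}))"
  proof
    assume "\<exists>\<sigma>. violating M I D c (\<sigma> 0) \<and> (\<forall>i. tuple_step M I D (\<sigma> i) (\<sigma> (Suc i))) \<and>
          (\<forall>j<?k. infinite {i. fair_at M I D j (\<sigma> i)})"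
    then obtain \<sigma> where \<sigma>: "violating M I D c (\<sigma> 0)" "\<forall>i. tuple_step M I D (\<sigma> i) (\<sigma> (Suc i))"
      "\<forall>j<?k. infinite {i. fair_at M I D j (\<sigma> i)}" by blast
    then obtain es0 where es0: "eval M I (state_of (vars D) es0) (init D)"
      "\<not> eval M I (state_of (vars D) es0) c" "(tuple_step M I D)\<^sup>*\<^sup>* es0 (\<sigma> 0)"
      by (auto simp: violating_def)
    obtain \<tau> where \<tau>: "\<tau> 0 = es0" "\<forall>i. tuple_step M I D (\<tau> i) (\<tau> (Suc i))"
      "\<forall>j<?k. infinite {i. fair_at M I D j (\<tau> i)}"
      using prepend_path[of "tuple_step M I D" es0 \<sigma> ?k "fair_at M I D", OF es0(3) \<sigma>(2,3)] by blast
    have "infinite {i. eval M I (state_of (vars D) (\<tau> i)) j}" if "j \<in> set (fair D)" for j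
    proof -
      obtain m where m: "m < length (fair D)" "j = fair D ! m" using \<open>j \<in> set (fair D)\<close>
        by (auto simp: in_set_conv_nth)
      with \<tau>(3) have "infinite {i. fair_at M I D m (\<tau> i)}" by simp
      then show ?thesis using m by (simp add: fair_at_def)
    qed
    then have "fair_path M I D (\<lambda>i. state_of (vars D) (\<tau> i))"
      using \<tau>(2) by (simp add: fair_path_def prog_path_def tuple_step_def)
    from no[OF this] show False using es0(1,2) \<tau>(1) by simp
  qed
qed simp

lemma holds_Imp_Nil [simp]: "holds M I (Imp b [] h) \<longleftrightarrow> (\<forall>\<rho>. eval M I \<rho> b \<longrightarrow> eval M I \<rho> h)"
proof -
  have "(\<forall>y. \<rho>' y = \<rho> y) \<longleftrightarrow> \<rho>' = \<rho>" for \<rho> \<rho>' :: "cvar \<Rightarrow> 'c"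
    by (simp add: fun_eq_iff)
  then show ?thesis by simp
qed

declare holds.simps(1) [simp del]

text \<open>The meanings of \<open>p\<close>, \<open>t\<close> and \<open>r\<close> are computed in
  \<open>I\<close>, but truth is asked for in \<open>J\<close>. Program and assertion use symbols of
  \<open>U\<close> only, so \<open>J\<close> evaluates them alike; then the clauses express closure
  properties of reachability, of the transitive closure and of rounds.\<close>

lemma clauses_Af_hold:
  assumes D: "prog_over U D" and J: "agree U I J" and c: "fv c \<subseteq> set (vars D)" "preds c \<subseteq> U"
    and no: "\<And>\<pi>. fair_path M I D \<pi> \<Longrightarrow> eval M I (\<pi> 0) (init D) \<Longrightarrow> eval M I (\<pi> 0) c"
    and p: "J p = {es. length es = length (vars D) \<and> violating M I D c es}"
    and t: "J t = tuple_pairs (length (vars D)) (tuple_step M I D)\<^sup>+\<^sup>+"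
    and r: "J r = tuple_pairs (length (vars D)) (fair_round M I D c)"
    and cl: "cl \<in> clauses_Af D c p r t"
  shows "holds M J cl"
proof -
  note ag = agree_sym[OF agree_state_of]
  have st: "step M J D s s' \<longleftrightarrow> tuple_step M I D (map s (vars D)) (map s' (vars D))" for s s'
    unfolding tuple_step_def by (rule step_cong[OF D agree_sym[OF J] ag ag])
  have ini: "eval M J s (init D) \<longleftrightarrow> eval M I (state_of (vars D) (map s (vars D))) (init D)" for s
    by (rule eval_init_cong[OF D agree_sym[OF J] ag])
  have ce: "eval M J s c \<longleftrightarrow> eval M I (state_of (vars D) (map s (vars D))) c" for s
    using agree_mono[OF agree_sym[OF J] c(2)] agree_mono[OF ag c(1)] by (intro eval_cong)
  have fe: "eval M J s (fair D ! i) \<Longrightarrow> fair_at M I D i (map s (vars D))" for s i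
    unfolding fair_at_def using eval_fair_cong[OF D agree_sym[OF J] ag] by (metis nth_mem)
  note pairs = p t r append_in_tuple_pairs eval_nxt[OF D] st
  consider
      "cl = Imp (And (at_copy 0 (init D)) (Neg (at_copy 0 c))) [] (app p (cp 0 (vars D)))"
    | "cl = Imp (And (nxt D) (app p (cp 0 (vars D)))) [] (app p (cp 1 (vars D)))"
    | "fair D \<noteq> []" "cl = Imp (And (app p (cp 0 (vars D)))
         (conjs (map (\<lambda>i. And (app t (cp (i - 1) (vars D) @ cp i (vars D))) (at_copy i (fair D ! (i - 1))))
           [1..<length (fair D) + 1]))) [] (app r (cp 0 (vars D) @ cp (length (fair D)) (vars D)))"
    | "fair D = []" "cl = Imp (And (app p (cp 0 (vars D))) (app t (cp 0 (vars D) @ cp 1 (vars D)))) []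
         (app r (cp 0 (vars D) @ cp 1 (vars D)))"
    | "cl = DWF r"
    | "cl = Imp (nxt D) [] (app t (cp 0 (vars D) @ cp 1 (vars D)))"
    | "cl = Imp (And (app t (cp 0 (vars D) @ cp 1 (vars D))) (shift_copy (nxt D))) []
         (app t (cp 0 (vars D) @ cp 2 (vars D)))"
    using cl unfolding clauses_Af_def Let_def by (auto split: if_splits)
  then show ?thesis
  proof cases
    case 1
    have "violating M I D c (map s (vars D))" if "eval M J s (init D)" "\<not> eval M J s c" for s
      using that unfolding violating_def ini ce by blast
    then show ?thesis by (auto simp: 1 p)
  next
    case 2
    have "violating M I D c es'" if "violating M I D c es" "tuple_step M I D es es'" for es es'
      using that unfolding violating_def by (meson rtranclp.rtrancl_into_rtrancl)
    then show ?thesis by (auto simp: 2 pairs)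
  next
    case 3
    let ?k = "length (fair D)"
    have "fair_round M I D c (map (\<lambda>x. \<rho> (x, 0)) (vars D)) (map (\<lambda>x. \<rho> (x, ?k)) (vars D))"
      if v: "violating M I D c (map (\<lambda>x. \<rho> (x, 0)) (vars D))"
        and i: "\<And>i. i \<in> set [1..<?k + 1] \<Longrightarrow>
          (tuple_step M I D)\<^sup>+\<^sup>+ (map (\<lambda>x. \<rho> (x, i - Suc 0)) (vars D)) (map (\<lambda>x. \<rho> (x, i)) (vars D)) \<and>
          eval M J (\<lambda>x. \<rho> (x, i)) (fair D ! (i - Suc 0))" for \<rho>
    proof -
      have "max 1 ?k = ?k" using 3(1) by (cases "fair D") auto
      moreover have "visits (tuple_step M I D)\<^sup>+\<^sup>+ (fair_at M I D) ?k
          (map (\<lambda>x. \<rho> (x, 0)) (vars D)) (map (\<lambda>x. \<rho> (x, ?k)) (vars D))"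
        unfolding visits_def
      \<comment> \<open>The copies of the variables in the valuation are themselves the successive
        stations of the round.\<close>
      proof (intro exI[of _ "\<lambda>i. map (\<lambda>x. \<rho> (x, i)) (vars D)"] conjI allI impI)
        fix j assume "j < ?k"
        then have "Suc j \<in> set [1..<?k + 1]" by auto
        from i[OF this] show
          "(tuple_step M I D)\<^sup>+\<^sup>+ (map (\<lambda>x. \<rho> (x, j)) (vars D)) (map (\<lambda>x. \<rho> (x, Suc j)) (vars D))"
          "fair_at M I D j (map (\<lambda>x. \<rho> (x, Suc j)) (vars D))"
          by (auto intro: fe)
      qed simp_all
      ultimately show ?thesis using v by (simp add: fair_round_def)
    qed
    then show ?thesis by (simp add: 3(2) pairs del: set_upt upt_Suc)
  next
    case 4
    have "fair_round M I D c es es'" if "violating M I D c es" "(tuple_step M I D)\<^sup>+\<^sup>+ es es'" for es es'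
    proof -
      \<comment> \<open>Without fairness conditions a round is one link of the closure, and the
        visit at its end is vacuous by \<open>fair_at\<close>.\<close>
      have "visits (tuple_step M I D)\<^sup>+\<^sup>+ (fair_at M I D) 1 es es'"
        unfolding visits_def using that(2) 4(1)
        by (intro exI[of _ "\<lambda>i. if i = 0 then es else es'"]) (simp add: fair_at_def)
      then show ?thesis using that 4(1) by (simp add: fair_round_def)
    qed
    then show ?thesis by (auto simp: 4(2) pairs)
  next
    case 5
    have "wf {(es', es). fair_round M I D c es es'}" by (rule wf_fair_round) (rule no)
    from disj_wf_tuple_pairs[OF this] show ?thesis by (simp add: 5 r)
  next
    case 6
    then show ?thesis by (auto simp: pairs)
  next
    case 7
    then show ?thesis by (auto simp: pairs numeral_2_eq_2 intro: tranclp.trancl_into_trancl)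
  qed
qed

section \<open>Existential path quantifiers over assertions\<close>

definition has_fair_path :: "('f, 'r, 'e) struct \<Rightarrow> 'e interp \<Rightarrow> ('f, 'r) prog \<Rightarrow> 'e state \<Rightarrow> bool" where
  "has_fair_path M I D s \<longleftrightarrow> (\<exists>\<pi>. fair_path M I D \<pi> \<and> \<pi> 0 = s)"

text \<open>The minimum ranges over all fair paths from \<open>s\<close>, so it is a function of the
  state and can serve as a measure. It is unspecified where no fair path starts; well-foundedness of
  the induced relation is unaffected, as any function into the natural numbers is a measure.\<close>

definition visit_time :: "('f, 'r, 'e) struct \<Rightarrow> 'e interp \<Rightarrow> ('f, 'r) prog \<Rightarrow> nat \<Rightarrow> 'e state \<Rightarrow> nat" where
  "visit_time M I D i s =
     (LEAST n. \<exists>\<pi>. (fair_path M I D \<pi> \<and> eval M I (\<pi> n) (fair D ! i)) \<and> \<pi> 0 = s)"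

lemma has_fair_path_cong:
  assumes "prog_over U D" "agree U I J" "agree (set (vars D)) s s'"
  shows "has_fair_path M I D s = has_fair_path M J D s'"
  unfolding has_fair_path_def
  using assms by (intro ex_path_cong[of "set (vars D)"] fair_path_cong)

lemma visit_time_cong:
  fixes s s' :: "'e state"
  assumes "prog_over U D" "i < length (fair D)" "agree (set (vars D)) s s'"
  shows "visit_time M I D i s = visit_time M I D i s'"
proof -
  have "(\<exists>\<pi>. (fair_path M I D \<pi> \<and> eval M I (\<pi> n) (fair D ! i)) \<and> \<pi> 0 = s) \<longleftrightarrow>
      (\<exists>\<pi>. (fair_path M I D \<pi> \<and> eval M I (\<pi> n) (fair D ! i)) \<and> \<pi> 0 = s')" for n
  proof (rule ex_path_cong[OF assms(3)])
    fix \<sigma> \<sigma>' :: "nat \<Rightarrow> 'e state" assume a: "\<And>i. agree (set (vars D)) (\<sigma> i) (\<sigma>' i)"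
    show "(fair_path M I D \<sigma> \<and> eval M I (\<sigma> n) (fair D ! i)) =
        (fair_path M I D \<sigma>' \<and> eval M I (\<sigma>' n) (fair D ! i))"
      by (intro arg_cong2[where f = "(\<and>)"] fair_path_cong[OF assms(1) agree_refl a]
          eval_fair_cong[OF assms(1) agree_refl a] nth_mem assms(2))
  qed
  then show ?thesis by (simp add: visit_time_def)
qed

lemma has_fair_path_step:
  assumes "has_fair_path M I D s"
  obtains s' where "step M I D s s'" "has_fair_path M I D s'"
proof -
  obtain \<pi> where \<pi>: "fair_path M I D \<pi>" "\<pi> 0 = s" using assms by (auto simp: has_fair_path_def)
  show thesis
  proof
    show "step M I D s (\<pi> 1)" using \<pi> by (auto simp: fair_path_def prog_path_def)
    show "has_fair_path M I D (\<pi> 1)"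
      unfolding has_fair_path_def using fair_path_suffix[OF \<pi>(1), of 1]
      by (intro exI[of _ "seq_suffix 1 \<pi>"]) simp
  qed
qed

text \<open>Follow a fair path on which the visit happens at the least possible time. If this time
  is zero, the condition holds at \<open>s\<close>; otherwise the tail of the path visits one step
  earlier, so the least time of the successor is smaller.\<close>

lemma has_fair_path_progress:
  assumes "has_fair_path M I D s" "i < length (fair D)"
  obtains s' where "step M I D s s'" "has_fair_path M I D s'"
    "eval M I s (fair D ! i) \<or> visit_time M I D i s' < visit_time M I D i s"
proof -
  let ?W = "\<lambda>s n. \<exists>\<pi>. (fair_path M I D \<pi> \<and> eval M I (\<pi> n) (fair D ! i)) \<and> \<pi> 0 = s"
  obtain \<pi> where \<pi>: "fair_path M I D \<pi>" "\<pi> 0 = s" using assms by (auto simp: has_fair_path_def)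
  then have "infinite {n. eval M I (\<pi> n) (fair D ! i)}" using assms(2) by (simp add: fair_path_def)
  \<comment> \<open>An infinite set of visits is nonempty, so the minimum in
    \<open>visit_time\<close> is attained.\<close>
  then have "{n. eval M I (\<pi> n) (fair D ! i)} \<noteq> {}" by (metis finite.emptyI)
  then have "\<exists>n. ?W s n" using \<pi> by blast
  then have "?W s (visit_time M I D i s)" unfolding visit_time_def by (rule LeastI_ex)
  then obtain \<pi> where \<pi>: "fair_path M I D \<pi>" "eval M I (\<pi> (visit_time M I D i s)) (fair D ! i)" "\<pi> 0 = s"
    by blast
  have suf: "fair_path M I D (seq_suffix 1 \<pi>)" by (rule fair_path_suffix[OF \<pi>(1)])
  show thesis
  proof
    show "step M I D s (\<pi> 1)" using \<pi> by (auto simp: fair_path_def prog_path_def)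
    show "has_fair_path M I D (\<pi> 1)"
      unfolding has_fair_path_def using suf by (intro exI[of _ "seq_suffix 1 \<pi>"]) simp
    show "eval M I s (fair D ! i) \<or> visit_time M I D i (\<pi> 1) < visit_time M I D i s"
    proof (cases "visit_time M I D i s")
      case 0
      then show ?thesis using \<pi> by simp
    next
      case (Suc n)
      have "?W (\<pi> 1) n"
        using suf \<pi>(2) Suc by (intro exI[of _ "seq_suffix 1 \<pi>"]) simp
      then have "visit_time M I D i (\<pi> 1) \<le> n" unfolding visit_time_def by (rule Least_le)
      then show ?thesis using Suc by simp
    qed
  qed
qed

text \<open>The head binds only copy 1 of the variables in \<open>v\<close>. The chosen successor
  \<open>s'\<close> can be stored there, but other names of copy 1 keep their old values; hence the
  head must follow from agreement with \<open>s'\<close> on \<open>v\<close>.\<close>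

lemma holds_Imp_exI:
  assumes "\<And>\<rho>. eval M J \<rho> b \<Longrightarrow> \<exists>s'. \<forall>\<rho>'. (\<lambda>x. \<rho>' (x, 0)) = (\<lambda>x. \<rho> (x, 0)) \<longrightarrow>
    agree (set v) s' (\<lambda>x. \<rho>' (x, 1)) \<longrightarrow> eval M J \<rho>' h"
  shows "holds M J (Imp b (cp 1 v) h)"
  unfolding holds.simps
proof (intro allI impI)
  fix \<rho> assume "eval M J \<rho> b"
  from assms[OF this] obtain s' where s': "\<And>\<rho>'. (\<lambda>x. \<rho>' (x, 0)) = (\<lambda>x. \<rho> (x, 0)) \<Longrightarrow>
    agree (set v) s' (\<lambda>x. \<rho>' (x, 1)) \<Longrightarrow> eval M J \<rho>' h" by blast
  let ?\<rho> = "\<lambda>(x, i). if i = 1 \<and> x \<in> set v then s' x else \<rho> (x, i)"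
  have "eval M J ?\<rho> h" by (rule s') (auto simp: agree_def)
  then show "\<exists>\<rho>'. (\<forall>y. y \<notin> set (cp 1 v) \<longrightarrow> \<rho>' y = \<rho> y) \<and> eval M J \<rho>' h"
    by (intro exI[of _ ?\<rho>]) auto
qed

text \<open>All \<open>qs\<close> have the same meaning, so handing over from one index to the
  cyclically next costs nothing. Which disjunct of the head holds is settled by
  \<open>has_fair_path_progress\<close>, and each \<open>rs ! i\<close> is transitive because it
  compares values of a measure.\<close>

lemma clauses_Ef_hold:
  assumes D: "prog_over U D" and J: "agree U I J" and c: "fv c \<subseteq> set (vars D)" "preds c \<subseteq> U"
    and mo: "\<And>s. eval M I s (init D) \<Longrightarrow> has_fair_path M I D s \<and> eval M I s c"
    and ne: "fair D \<noteq> []" and len: "length qs = length (fair D)"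
    and q: "\<And>q. q \<in> set qs \<Longrightarrow> J q = tuples (vars D) (has_fair_path M I D)"
    and r: "\<And>i. i < length (fair D) \<Longrightarrow> J (rs ! i) = tuple_pairs (length (vars D))
      (\<lambda>es es'. visit_time M I D i (state_of (vars D) es') < visit_time M I D i (state_of (vars D) es))"
    and cl: "cl \<in> clauses_Ef D c qs rs"
  shows "holds M J cl"
proof -
  let ?v = "vars D" and ?k = "length (fair D)"
  have st: "step M J D s s' \<longleftrightarrow> step M I D s s'" for s s'
    by (rule step_cong[OF D agree_sym[OF J] agree_refl agree_refl])
  have st': "step M I D s s' \<Longrightarrow> agree (set ?v) s' s'' \<Longrightarrow> step M I D s s''" for s s' s''
    by (rule iffD1[OF step_cong[OF D agree_refl agree_refl]])
  have qm: "map s ?v \<in> J q \<longleftrightarrow> has_fair_path M I D s" if "q \<in> set qs" for q s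
    unfolding q[OF that] by (rule map_in_tuples) (rule has_fair_path_cong[OF D agree_refl])
  have rm: "map s ?v @ map s' ?v \<in> J (rs ! i) \<longleftrightarrow> visit_time M I D i s' < visit_time M I D i s"
    if "i < ?k" for s s' i
    using visit_time_cong[where I = I and M = M, OF D that agree_state_of] by (simp add: r[OF that] append_in_tuple_pairs)
  from cl consider
      "cl = Imp (at_copy 0 (init D)) [] (And (at_copy 0 c) (app (qs ! 0) (cp 0 ?v)))"
    | i where "i < ?k" "cl = Imp (app (qs ! i) (cp 0 ?v)) (cp 1 ?v)
          (And (nxt D)
            (Or (And (at_copy 0 (fair D ! i)) (app (qs ! ((i + 1) mod ?k)) (cp 1 ?v)))
                (And (app (rs ! i) (cp 0 ?v @ cp 1 ?v)) (app (qs ! i) (cp 1 ?v)))))"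
    | i where "i < ?k" "cl = DWF (rs ! i)"
    | i where "i < ?k" "cl = Imp (And (app (rs ! i) (cp 0 ?v @ cp 1 ?v)) (app (rs ! i) (cp 1 ?v @ cp 2 ?v))) []
          (app (rs ! i) (cp 0 ?v @ cp 2 ?v))"
    unfolding clauses_Ef_def Let_def by auto
  then show ?thesis
  proof cases
    case 1
    have "has_fair_path M I D s \<and> eval M J s c" if "eval M J s (init D)" for s
    proof -
      have "eval M I s (init D)" using that by (rule iffD2[OF eval_init_cong[OF D J agree_refl]])
      moreover have "eval M I s c = eval M J s c"
        using agree_mono[OF J c(2)] by (intro eval_cong) simp_all
      ultimately show ?thesis using mo by simp
    qed
    moreover have "qs ! 0 \<in> set qs" using ne len by (intro nth_mem) simp
    ultimately show ?thesis by (simp add: 1 qm)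
  next
    case 2
    have "(i + 1) mod ?k < ?k" using 2(1) by (intro mod_less_divisor) linarith
    then have qi: "qs ! i \<in> set qs" "qs ! ((i + 1) mod ?k) \<in> set qs"
      using 2(1) unfolding len[symmetric] by simp_all
    show ?thesis unfolding 2(2)
    proof (rule holds_Imp_exI)
      fix \<rho> :: "cvar \<Rightarrow> 'c"
      let ?s = "\<lambda>x. \<rho> (x, 0)"
      assume "eval M J \<rho> (app (qs ! i) (cp 0 ?v))"
      then have "has_fair_path M I D ?s" by (simp add: qm[OF qi(1)])
      then obtain s' where s': "step M I D ?s s'" "has_fair_path M I D s'"
        "eval M I ?s (fair D ! i) \<or> visit_time M I D i s' < visit_time M I D i ?s"
        using has_fair_path_progress 2(1) by blast
      show "\<exists>s'. \<forall>\<rho>'. (\<lambda>x. \<rho>' (x, 0)) = ?s \<longrightarrow> agree (set ?v) s' (\<lambda>x. \<rho>' (x, 1)) \<longrightarrow>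
         eval M J \<rho>' (And (nxt D)
            (Or (And (at_copy 0 (fair D ! i)) (app (qs ! ((i + 1) mod ?k)) (cp 1 ?v)))
                (And (app (rs ! i) (cp 0 ?v @ cp 1 ?v)) (app (qs ! i) (cp 1 ?v)))))"
      proof (intro exI[of _ s'] allI impI)
        fix \<rho>' :: "cvar \<Rightarrow> 'c"
        let ?s'' = "\<lambda>x. \<rho>' (x, 1)"
        assume r0: "(\<lambda>x. \<rho>' (x, 0)) = ?s" and a: "agree (set ?v) s' ?s''"
        have h: "has_fair_path M I D ?s''"
          using s'(2) by (rule iffD1[OF has_fair_path_cong[OF D agree_refl a]])
        have t: "visit_time M I D i ?s'' = visit_time M I D i s'"
          by (rule visit_time_cong[OF D 2(1) a, symmetric])
        have f: "eval M J ?s (fair D ! i) = eval M I ?s (fair D ! i)"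
          by (rule eval_fair_cong[OF D agree_sym[OF J] agree_refl nth_mem[OF 2(1)]])
        show "eval M J \<rho>' (And (nxt D)
            (Or (And (at_copy 0 (fair D ! i)) (app (qs ! ((i + 1) mod ?k)) (cp 1 ?v)))
                (And (app (rs ! i) (cp 0 ?v @ cp 1 ?v)) (app (qs ! i) (cp 1 ?v)))))"
          unfolding eval.simps eval_nxt[OF D] st eval_at_copy eval_app map_append map_cp r0 f
            qm[OF qi(1)] qm[OF qi(2)] rm[OF 2(1)] t
          using st'[OF s'(1) a] h s'(3) by blast
      qed
    qed
  next
    case 3
    have "wf {(es', es). visit_time M I D i (state_of ?v es') < visit_time M I D i (state_of ?v es)}"
      by (rule wf_subset[OF wf_measure[of "\<lambda>es. visit_time M I D i (state_of ?v es)"]]) auto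
    from disj_wf_tuple_pairs[OF this] show ?thesis by (simp add: 3 r)
  next
    case 4
    show ?thesis by (auto simp: 4(2) rm[OF 4(1)])
  qed
qed

lemma clauses_Ef_unfair_hold:
  assumes D: "prog_over U D" and J: "agree U I J" and c: "fv c \<subseteq> set (vars D)" "preds c \<subseteq> U"
    and mo: "\<And>s. eval M I s (init D) \<Longrightarrow> has_fair_path M I D s \<and> eval M I s c"
    and q: "J q = tuples (vars D) (has_fair_path M I D)"
    and cl: "cl \<in> clauses_Ef_unfair D c q"
  shows "holds M J cl"
proof -
  let ?v = "vars D"
  have st: "step M J D s s' \<longleftrightarrow> step M I D s s'" for s s'
    by (rule step_cong[OF D agree_sym[OF J] agree_refl agree_refl])
  have st': "step M I D s s' \<Longrightarrow> agree (set ?v) s' s'' \<Longrightarrow> step M I D s s''" for s s' s''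
    by (rule iffD1[OF step_cong[OF D agree_refl agree_refl]])
  have qm: "map s ?v \<in> J q \<longleftrightarrow> has_fair_path M I D s" for s
    unfolding q by (rule map_in_tuples) (rule has_fair_path_cong[OF D agree_refl])
  from cl consider
      "cl = Imp (at_copy 0 (init D)) [] (And (at_copy 0 c) (app q (cp 0 ?v)))"
    | "cl = Imp (app q (cp 0 ?v)) (cp 1 ?v) (And (nxt D) (app q (cp 1 ?v)))"
    unfolding clauses_Ef_unfair_def Let_def by auto
  then show ?thesis
  proof cases
    case 1
    have "has_fair_path M I D s \<and> eval M J s c" if "eval M J s (init D)" for s
    proof -
      have "eval M I s (init D)" using that by (rule iffD2[OF eval_init_cong[OF D J agree_refl]])
      moreover have "eval M I s c = eval M J s c"
        using agree_mono[OF J c(2)] by (intro eval_cong) simp_all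
      ultimately show ?thesis using mo by simp
    qed
    then show ?thesis by (simp add: 1 qm)
  next
    case 2
    show ?thesis unfolding 2
    proof (rule holds_Imp_exI)
      fix \<rho> :: "cvar \<Rightarrow> 'c"
      let ?s = "\<lambda>x. \<rho> (x, 0)"
      assume "eval M J \<rho> (app q (cp 0 ?v))"
      then have "has_fair_path M I D ?s" by (simp add: qm)
      then obtain s' where s': "step M I D ?s s'" "has_fair_path M I D s'"
        by (rule has_fair_path_step)
      show "\<exists>s'. \<forall>\<rho>'. (\<lambda>x. \<rho>' (x, 0)) = ?s \<longrightarrow> agree (set ?v) s' (\<lambda>x. \<rho>' (x, 1)) \<longrightarrow>
         eval M J \<rho>' (And (nxt D) (app q (cp 1 ?v)))"
      proof (intro exI[of _ s'] allI impI)
        fix \<rho>' :: "cvar \<Rightarrow> 'c"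
        assume r0: "(\<lambda>x. \<rho>' (x, 0)) = ?s" and a: "agree (set ?v) s' (\<lambda>x. \<rho>' (x, 1))"
        show "eval M J \<rho>' (And (nxt D) (app q (cp 1 ?v)))"
          unfolding eval.simps eval_nxt[OF D] st eval_app map_cp r0 qm
          by (rule conjI[OF st'[OF s'(1) a] iffD1[OF has_fair_path_cong[OF D agree_refl a] s'(2)]])
      qed
    qed
  qed
qed


section \<open>The translation\<close>

lemma models_Qu:
  "models M I D (Qu QA \<psi>) \<longleftrightarrow>
     (\<forall>\<pi>. prog_path M I D \<pi> \<longrightarrow> eval M I (\<pi> 0) (init D) \<longrightarrow> sat M I D \<pi> \<psi>)"
  "models M I D (Qu QE \<psi>) \<longleftrightarrow>
     (\<forall>s. eval M I s (init D) \<longrightarrow> (\<exists>\<pi>. prog_path M I D \<pi> \<and> \<pi> 0 = s \<and> sat M I D \<pi> \<psi>))"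
  "models M I D (Qu QAf \<psi>) \<longleftrightarrow>
     (\<forall>\<pi>. fair_path M I D \<pi> \<longrightarrow> eval M I (\<pi> 0) (init D) \<longrightarrow> sat M I D \<pi> \<psi>)"
  "models M I D (Qu QEf \<psi>) \<longleftrightarrow>
     (\<forall>s. eval M I s (init D) \<longrightarrow> (\<exists>\<pi>. fair_path M I D \<pi> \<and> \<pi> 0 = s \<and> sat M I D \<pi> \<psi>))"
  by (auto simp: models_def sat_state_def)

lemma models_cong:
  assumes "prog_over U D" "fm_over (vars D) U \<phi>" "agree U I J" "models M I D \<phi>"
  shows "models M J D \<phi>"
  unfolding models_def
proof (intro allI impI)
  fix s assume "eval M J s (init D)"
  then have "eval M I s (init D)" using eval_init_cong[OF assms(1,3) agree_refl] by blast
  then have "sat M I D (\<lambda>_. s) \<phi>" using assms(4) by (simp add: models_def sat_state_def)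
  then show "sat_state M J D s \<phi>"
    unfolding sat_state_def by (rule iffD1[OF sat_cong[OF assms(1,3,2) agree_refl]])
qed

section \<open>Extending interpretations by fresh symbols\<close>

lemma translates_mono: "translates U D \<phi> C U' \<Longrightarrow> U \<subseteq> U'"
  by (induction rule: translates.induct) auto

lemma agree_upd_fresh: "p \<notin> U \<Longrightarrow> agree U I (I(p := X))"
  by (auto simp: agree_def)

lemma prog_over_no_fairness: "prog_over U D \<Longrightarrow> prog_over U (D\<lparr>fair := []\<rparr>)"
  by (auto simp: prog_over_def preds_prog_def)

lemma prog_over_init:
  "prog_over U D \<Longrightarrow> aux \<in> U \<Longrightarrow> prog_over U (D\<lparr>init := app aux (vars D)\<rparr>)"
  by (auto simp: prog_over_def preds_prog_def)

lemma interpretation_upd: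
  "interpretation_of_preds I \<Longrightarrow> X \<subseteq> {es. length es = arity p} \<Longrightarrow>
   interpretation_of_preds (I(p := X))"
  by (simp add: interpretation_of_preds_def)

lemma tuples_length: "tuples v P \<subseteq> {es. length es = length v}"
  by (auto simp: tuples_def)

text \<open>The quantification over \<open>J\<close> protects the clauses against later calls: these
  may interpret symbols outside \<open>U'\<close> at will. It also replaces any bookkeeping of the
  predicates that occur in \<open>C\<close>.\<close>

definition extension_satisfying :: "('f, 'r, 'e) struct \<Rightarrow> psym set \<Rightarrow> 'e interp \<Rightarrow> ('f, 'r) clause set \<Rightarrow> psym set \<Rightarrow> bool" where
  "extension_satisfying M U I C U' \<longleftrightarrow>
     (\<exists>I'. interpretation_of_preds I' \<and> agree U I I' \<and>
        (\<forall>J. agree U' I' J \<longrightarrow> (\<forall>cl\<in>C. holds M J cl)))"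

text \<open>With \<open>aux\<close> denoting exactly the states that satisfy \<open>\<phi>1\<close>,
  the first call starts from a true claim, and the replacement preserves the truth of
  \<open>\<phi>2\<close>. The second call extends the interpretation found by the first without
  touching \<open>U1\<close>, so the clauses \<open>C1\<close> persist.\<close>

lemma satisfying_split_state:
  assumes D: "prog_over U D" and \<phi>2: "fm_over (vars D) U \<phi>2" and I: "interpretation_of_preds I"
    and mo: "models M I D \<phi>2"
    and Q: "\<phi>1 = Qu q \<psi>" and aux: "aux \<notin> U" "arity aux = length (vars D)"
    and repl: "replaces \<phi>1 (Asn (app aux (vars D))) \<phi>2 \<phi>2'"
    and mono: "insert aux U \<subseteq> U1" "U1 \<subseteq> U2"
    and IH1: "\<And>I. prog_over (insert aux U) (D\<lparr>init := app aux (vars D)\<rparr>) \<Longrightarrow>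
      fm_over (vars D) (insert aux U) \<phi>1 \<Longrightarrow> interpretation_of_preds I \<Longrightarrow>
      models M I (D\<lparr>init := app aux (vars D)\<rparr>) \<phi>1 \<Longrightarrow> extension_satisfying M (insert aux U) I C1 U1"
    and IH2: "\<And>I. prog_over U1 D \<Longrightarrow> fm_over (vars D) U1 \<phi>2' \<Longrightarrow> interpretation_of_preds I \<Longrightarrow>
      models M I D \<phi>2' \<Longrightarrow> extension_satisfying M U1 I C2 U2"
  shows "extension_satisfying M U I (C1 \<union> C2) U2"
proof -
  let ?v = "vars D" and ?aux = "app aux (vars D)"
  define I1 where "I1 = I(aux := tuples ?v (\<lambda>s. sat M I D (\<lambda>_. s) \<phi>1))"
  have UI1: "agree U I I1" unfolding I1_def by (rule agree_upd_fresh[OF aux(1)])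
  have int1: "interpretation_of_preds I1"
    unfolding I1_def by (intro interpretation_upd[OF I]) (simp only: aux(2) tuples_length)
  have \<phi>1: "fm_over ?v U \<phi>1" by (rule replaces_fm_over_subformula[OF repl \<phi>2])
  have D': "prog_over (insert aux U) D" by (rule prog_over_mono[OF D]) blast
  have \<phi>1': "fm_over ?v (insert aux U) \<phi>1" by (rule fm_over_mono[OF \<phi>1]) blast+
  have in_aux: "map s ?v \<in> I1 aux \<longleftrightarrow> sat M I D (\<lambda>_. s) \<phi>1" for s
    unfolding I1_def fun_upd_same by (rule map_in_tuples) (rule sat_cong[OF D agree_refl \<phi>1])
  have eq: "sat M I1 D \<pi> \<phi>1 = sat M I1 D \<pi> (Asn ?aux)" for \<pi>
  proof -
    have "sat M I1 D \<pi> \<phi>1 = sat M I D \<pi> \<phi>1"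
      by (rule sat_cong[OF D UI1 \<phi>1 agree_refl, symmetric])
    \<comment> \<open>\<open>\<phi>1\<close> begins with a path quantifier, so only the first state
      of the sequence matters.\<close>
    also have "\<dots> = sat M I D (\<lambda>_. \<pi> 0) \<phi>1" by (simp add: Q)
    finally show ?thesis by (simp add: in_aux)
  qed
  have "models M I1 (D\<lparr>init := ?aux\<rparr>) \<phi>1"
    using eq by (simp add: models_def sat_state_def)
  from IH1[OF prog_over_init[OF D'] \<phi>1' int1 this]
  obtain I2 where int2: "interpretation_of_preds I2" and I12: "agree (insert aux U) I1 I2"
    and C1: "\<And>J. agree U1 I2 J \<Longrightarrow> \<forall>cl\<in>C1. holds M J cl"
    by (auto simp: extension_satisfying_def)
  have "fm_over ?v (insert aux U) (Asn ?aux)" by (simp add: fm_over_def)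
  from replaces_fm_over[OF repl fm_over_mono[OF \<phi>2 subset_refl subset_insertI] this]
  have \<phi>2': "fm_over ?v (insert aux U) \<phi>2'" .
  have "models M I1 D \<phi>2" by (rule models_cong[OF D \<phi>2 UI1 mo])
  then have "models M I1 D \<phi>2'"
    using replaces_sat[OF eq repl] by (simp add: models_def sat_state_def)
  then have "models M I2 D \<phi>2'" by (rule models_cong[OF D' \<phi>2' I12])
  from IH2[OF prog_over_mono[OF D' mono(1)] fm_over_mono[OF \<phi>2' subset_refl mono(1)] int2 this]
  obtain I3 where int3: "interpretation_of_preds I3" and I23: "agree U1 I2 I3"
    and C2: "\<And>J. agree U2 I3 J \<Longrightarrow> \<forall>cl\<in>C2. holds M J cl"
    by (auto simp: extension_satisfying_def)
  have "agree U I I3"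
    using UI1 I12 I23 mono(1) by (auto simp: agree_def)
  moreover have "\<forall>cl\<in>C1 \<union> C2. holds M J cl" if "agree U2 I3 J" for J
    using C1[OF agree_trans[OF I23 agree_mono[OF that mono(2)]]] C2[OF that] by blast
  ultimately show ?thesis using int3 unfolding extension_satisfying_def by blast
qed

lemma extend_prog_fm_over:
  assumes el: "elim_temporal (vars D) x \<theta> a js" and repl: "replaces \<theta> (Asn (bvar x)) \<psi> \<psi>'"
    and \<psi>: "fm_over (vars D) U \<psi>"
  shows "fm_over (vars (extend_prog D x a js)) U \<psi>'"
  using repl
  by (rule replaces_fm_over) (use fm_over_mono[OF \<psi>, of "vars D @ [x]" U] in \<open>auto simp: fm_over_def\<close>)

text \<open>Replacement takes place inside the extended program, along a fair path on which
  \<open>x\<close> is right; moving from there to \<open>D\<close> is harmless because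
  \<open>\<psi>\<close> contains no path quantifier.\<close>

lemma replaces_temporal_sat:
  assumes "quantifier_free \<psi>" "elim_temporal (vars D) x \<theta> a js" "replaces \<theta> (Asn (bvar x)) \<psi> \<psi>'"
    "true_of M \<noteq> false_of M" "fair_path M I (extend_prog D x a js) \<pi>"
  shows "sat M I D \<pi> \<psi> = sat M I (extend_prog D x a js) \<pi> \<psi>'"
proof -
  let ?D = "extend_prog D x a js"
  have "sat M I ?D (seq_suffix i \<pi>) \<theta> = sat M I ?D (seq_suffix i \<pi>) (Asn (bvar x))" for i
    using elim_temporal_sat[OF assms(2,4,5)] by simp
  from replaces_sat_path[OF assms(3,1) _ this]
  have "sat M I ?D \<pi> \<psi> = sat M I ?D \<pi> \<psi>'" by simp
  then show ?thesis using sat_quantifier_free[OF assms(1)] by metis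
qed

text \<open>Fair paths of the extended program are fair paths of \<open>D\<close>. The initial
  condition may leave \<open>x\<close> unconstrained, since a path on which \<open>x\<close> starts
  with a wrong value is not fair.\<close>

lemma models_temporal_Af:
  assumes "quantifier_free \<psi>" "elim_temporal (vars D) x \<theta> a js" "replaces \<theta> (Asn (bvar x)) \<psi> \<psi>'"
    "true_of M \<noteq> false_of M" "models M I D (Qu QAf \<psi>)"
  shows "models M I (extend_prog D x a js) (Qu QAf \<psi>')"
  using assms(5) replaces_temporal_sat[OF assms(1-4)] fair_path_extend_progD
  unfolding models_Qu init_extend_prog by blast

lemma exists_temporal_Ef:
  assumes qf: "quantifier_free \<psi>" and el: "elim_temporal (vars D) x \<theta> a js"
    and repl: "replaces \<theta> (Asn (bvar x)) \<psi> \<psi>'" and tf: "true_of M \<noteq> false_of M"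
    and D: "prog_over U D" and \<psi>: "fm_over (vars D) U \<psi>"
    and \<pi>: "fair_path M I D \<pi>" "sat M I D \<pi> \<psi>"
  obtains \<pi>' e where "fair_path M I (extend_prog D x a js) \<pi>'" "\<pi>' 0 = (\<pi> 0)(x := e)"
    "sat M I (extend_prog D x a js) \<pi>' \<psi>'"
proof -
  have \<theta>: "fm_over (vars D) U \<theta>" by (rule replaces_fm_over_subformula[OF repl \<psi>])
  have x: "x \<notin> set (vars D)" by (rule elim_temporal_fresh[OF el])
  define b where "b i = (if sat M I D (seq_suffix i \<pi>) \<theta> then true_of M else false_of M)" for i
  define \<pi>' where "\<pi>' i = (\<pi> i)(x := b i)" for i
  have fp: "fair_path M I (extend_prog D x a js) \<pi>'"
    using elim_temporal_path[OF el tf D \<theta> \<pi>(1)] by (simp add: \<pi>'_def[abs_def] b_def)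
  have "sat M I D \<pi>' \<psi> = sat M I D \<pi> \<psi>"
    using x by (intro sat_cong[OF D agree_refl \<psi>]) (auto simp: \<pi>'_def agree_def)
  then have "sat M I (extend_prog D x a js) \<pi>' \<psi>'"
    using replaces_temporal_sat[OF qf el repl tf fp] \<pi>(2) by simp
  then show thesis using that fp by (simp add: \<pi>'_def)
qed

text \<open>The right initial value of \<open>x\<close> foretells the future of the chosen path, so
  it is no function of the state: hence the existential head. The predicate \<open>aux\<close>
  collects the extended states from which a fair path satisfies \<open>\<psi>'\<close>.\<close>

lemma satisfying_temporal_Ef:
  assumes qf: "quantifier_free \<psi>" and el: "elim_temporal (vars D) x \<theta> a js"
    and repl: "replaces \<theta> (Asn (bvar x)) \<psi> \<psi>'" and tf: "true_of M \<noteq> false_of M"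
    and aux: "aux \<notin> U" "arity aux = length (vars D) + 1" and mono: "insert aux U \<subseteq> U'"
    and D: "prog_over U D" and \<psi>: "fm_over (vars D) U \<psi>" and I: "interpretation_of_preds I"
    and mo: "models M I D (Qu QEf \<psi>)"
    and IH: "\<And>I. prog_over (insert aux U) ((extend_prog D x a js)\<lparr>init := app aux (vars D @ [x])\<rparr>) \<Longrightarrow>
      fm_over (vars D @ [x]) (insert aux U) (Qu QEf \<psi>') \<Longrightarrow> interpretation_of_preds I \<Longrightarrow>
      models M I ((extend_prog D x a js)\<lparr>init := app aux (vars D @ [x])\<rparr>) (Qu QEf \<psi>') \<Longrightarrow>
      extension_satisfying M (insert aux U) I C U'"
  shows "extension_satisfying M U I
    (insert (Imp (at_copy 0 (init D)) [(x, 0)] (app aux (cp 0 (vars D @ [x])))) C) U'"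
proof -
  let ?D = "extend_prog D x a js" and ?w = "vars D @ [x]"
  have \<theta>: "fm_over (vars D) U \<theta>" by (rule replaces_fm_over_subformula[OF repl \<psi>])
  have x: "x \<notin> set (vars D)" by (rule elim_temporal_fresh[OF el])
  have D': "prog_over U ?D" by (rule extend_prog_over[OF el \<theta> D])
  have \<psi>': "fm_over ?w U (Qu QEf \<psi>')"
    using extend_prog_fm_over[OF el repl \<psi>] by (simp add: fm_over_def)
  define P where "P s \<longleftrightarrow> sat M I ?D (\<lambda>_. s) (Qu QEf \<psi>')" for s
  define I1 where "I1 = I(aux := tuples ?w P)"
  have UI1: "agree U I I1" unfolding I1_def by (rule agree_upd_fresh[OF aux(1)])
  have int1: "interpretation_of_preds I1"
    unfolding I1_def using tuples_length[of ?w P] aux(2) by (intro interpretation_upd[OF I]) simp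
  have in_aux: "map s ?w \<in> I1 aux \<longleftrightarrow> P s" for s
  proof -
    have "sat M I ?D (\<lambda>_. s) (Qu QEf \<psi>') = sat M I ?D (\<lambda>_. s') (Qu QEf \<psi>')"
      if "agree (set ?w) s s'" for s s'
      by (rule sat_cong[OF D' agree_refl]) (use \<psi>' that in simp_all)
    then show ?thesis unfolding I1_def fun_upd_same P_def by (rule map_in_tuples)
  qed
  have "models M I1 (?D\<lparr>init := app aux ?w\<rparr>) (Qu QEf \<psi>')"
    unfolding models_def
  proof (intro allI impI)
    fix s assume "eval M I1 s (init (?D\<lparr>init := app aux ?w\<rparr>))"
    then have "map s ?w \<in> I1 aux" by simp
    then have "sat M I ?D (\<lambda>_. s) (Qu QEf \<psi>')" unfolding in_aux P_def .
    then have "sat M I1 ?D (\<lambda>_. s) (Qu QEf \<psi>')"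
      by (rule iffD1[OF sat_cong[OF D' UI1 _ agree_refl], rotated]) (use \<psi>' in simp)
    then show "sat_state M I1 (?D\<lparr>init := app aux ?w\<rparr>) s (Qu QEf \<psi>')"
      unfolding sat_state_def sat_init .
  qed
  moreover have "prog_over (insert aux U) (?D\<lparr>init := app aux ?w\<rparr>)"
    using prog_over_init[OF prog_over_mono[OF D' subset_insertI], of aux aux] by simp
  moreover have "fm_over ?w (insert aux U) (Qu QEf \<psi>')"
    by (rule fm_over_mono[OF \<psi>']) blast+
  ultimately have "extension_satisfying M (insert aux U) I1 C U'" using int1 by (intro IH)
  then obtain I2 where int2: "interpretation_of_preds I2" and I12: "agree (insert aux U) I1 I2"
    and C: "\<And>J. agree U' I2 J \<Longrightarrow> \<forall>cl\<in>C. holds M J cl"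
    by (auto simp: extension_satisfying_def)
  have "holds M J (Imp (at_copy 0 (init D)) [(x, 0)] (app aux (cp 0 ?w)))" if J: "agree U' I2 J" for J
    unfolding holds.simps
  proof (intro allI impI)
    fix \<rho> assume "eval M J \<rho> (at_copy 0 (init D))"
    let ?s = "\<lambda>x. \<rho> (x, 0)"
    have J': "agree (insert aux U) I1 J" using I12 J mono by (auto simp: agree_def)
    then have "agree U I J" using UI1 by (auto simp: agree_def)
    then have "eval M I ?s (init D)"
      using \<open>eval M J \<rho> (at_copy 0 (init D))\<close> eval_init_cong[OF D _ agree_refl, of I J M ?s] by simp
    then obtain \<pi> where \<pi>: "fair_path M I D \<pi>" "\<pi> 0 = ?s" "sat M I D \<pi> \<psi>"
      using mo by (auto simp: models_Qu)
    then obtain \<pi>' e where \<pi>': "fair_path M I ?D \<pi>'" "\<pi>' 0 = (\<pi> 0)(x := e)" "sat M I ?D \<pi>' \<psi>'"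
      using exists_temporal_Ef[OF qf el repl tf D \<psi>] by metis
    \<comment> \<open>The value \<open>e\<close> is the label that the chosen fair path carries at
      its first position.\<close>
    then have "P (?s(x := e))" using \<pi>(2) by (auto simp: P_def)
    then have "map (?s(x := e)) ?w \<in> J aux"
      using J' unfolding in_aux[symmetric] by (simp add: agree_def)
    moreover have "(\<lambda>y. (\<rho>((x, 0) := e)) (y, 0)) = ?s(x := e)" by auto
    ultimately have "eval M J (\<rho>((x, 0) := e)) (app aux (cp 0 ?w))"
      unfolding eval_app map_cp by simp
    then show "\<exists>\<rho>'. (\<forall>y. y \<notin> set [(x, 0)] \<longrightarrow> \<rho>' y = \<rho> y) \<and> eval M J \<rho>' (app aux (cp 0 ?w))"
      by (intro exI[of _ "\<rho>((x, 0) := e)"]) simp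
  qed
  moreover have "agree U I I2" using UI1 I12 by (auto simp: agree_def)
  ultimately show ?thesis using int2 C unfolding extension_satisfying_def by blast
qed

lemma satisfying_assertion_Af:
  assumes "as_assertion \<psi> = Some c" and dist: "distinct [p, r, t]" "{p, r, t} \<inter> U = {}"
    and ar: "arity p = length (vars D)" "arity r = 2 * length (vars D)" "arity t = 2 * length (vars D)"
    and D: "prog_over U D" and \<psi>: "fm_over (vars D) U \<psi>" and I: "interpretation_of_preds I"
    and mo: "models M I D (Qu QAf \<psi>)"
  shows "extension_satisfying M U I (clauses_Af D c p r t) (U \<union> {p, r, t})"
proof -
  define I' where "I' = I(p := {es. length es = length (vars D) \<and> violating M I D c es},
    t := tuple_pairs (length (vars D)) (tuple_step M I D)\<^sup>+\<^sup>+,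
    r := tuple_pairs (length (vars D)) (fair_round M I D c))"
  have "interpretation_of_preds I'"
    unfolding I'_def using ar length_tuple_pairs
    by (intro interpretation_upd I) auto
  moreover have UI': "agree U I I'" using dist(2) by (auto simp: I'_def agree_def)
  moreover have "holds M J cl" if J: "agree (U \<union> {p, r, t}) I' J" and cl: "cl \<in> clauses_Af D c p r t" for J cl
  proof (rule clauses_Af_hold[OF D _ _ _ _ _ _ _ cl])
    show "agree U I J" by (rule agree_trans[OF UI' agree_mono[OF J]]) blast
    show "fv c \<subseteq> set (vars D)" "preds c \<subseteq> U" using fm_over_as_assertion[OF assms(1) \<psi>] by auto
    show "eval M I (\<pi> 0) c" if "fair_path M I D \<pi>" "eval M I (\<pi> 0) (init D)" for \<pi>
      using that mo by (simp add: models_Qu sat_as_assertion[OF assms(1)])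
  qed (use J dist(1) not_sym[of t r] in \<open>auto simp: agree_def I'_def\<close>)
  ultimately show ?thesis unfolding extension_satisfying_def by blast
qed

lemma has_fair_path_models:
  assumes "as_assertion \<psi> = Some c" "models M I D (Qu QEf \<psi>)" "eval M I s (init D)"
  shows "has_fair_path M I D s \<and> eval M I s c"
  using assms(2,3) by (auto simp: models_Qu has_fair_path_def sat_as_assertion[OF assms(1)])

lemma satisfying_assertion_Ef:
  assumes c: "as_assertion \<psi> = Some c" and ne: "fair D \<noteq> []"
    and len: "length qs = length (fair D)" "length rs = length (fair D)"
    and dist: "distinct (qs @ rs)" "set (qs @ rs) \<inter> U = {}"
    and ar: "\<forall>q \<in> set qs. arity q = length (vars D)" "\<forall>r \<in> set rs. arity r = 2 * length (vars D)"
    and D: "prog_over U D" and \<psi>: "fm_over (vars D) U \<psi>" and I: "interpretation_of_preds I"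
    and mo: "models M I D (Qu QEf \<psi>)"
  shows "extension_satisfying M U I (clauses_Ef D c qs rs) (U \<union> set (qs @ rs))"
proof -
  define R where "R i = tuple_pairs (length (vars D))
    (\<lambda>es es'. visit_time M I D i (state_of (vars D) es') < visit_time M I D i (state_of (vars D) es))" for i
  \<comment> \<open>The meaning of a symbol in \<open>rs\<close> depends on its index, so it is
    looked up in a table; distinctness of \<open>qs @ rs\<close> makes the lookup return
    \<open>R i\<close> for \<open>rs ! i\<close>.\<close>
  define I' where "I' p = (if p \<in> set qs then tuples (vars D) (has_fair_path M I D)
    else case map_of (zip rs (map R [0..<length rs])) p of Some X \<Rightarrow> X | None \<Rightarrow> I p)" for p
  have Iq: "I' q = tuples (vars D) (has_fair_path M I D)" if "q \<in> set qs" for q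
    using that by (simp add: I'_def)
  have Ir: "I' (rs ! i) = R i" if "i < length rs" for i
  proof -
    have "rs ! i \<notin> set qs" using dist(1) that by (auto dest: nth_mem)
    moreover have "map_of (zip rs (map R [0..<length rs])) (rs ! i) = Some (R i)"
      using dist(1) that by (simp add: map_of_zip_nth)
    ultimately show ?thesis by (simp add: I'_def)
  qed
  have Io: "I' p = I p" if "p \<notin> set (qs @ rs)" for p
  proof -
    have none: "map_of (zip rs (map R [0..<length rs])) p = None" and "p \<notin> set qs"
      using that by (simp_all add: map_of_zip_is_None)
    then show ?thesis by (simp only: I'_def none if_False option.case)
  qed
  have "I' p \<subseteq> {es. length es = arity p}" for p
  proof (cases "p \<in> set (qs @ rs)")
    case False
    then show ?thesis using Io[OF False] I by (simp add: interpretation_of_preds_def)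
  next
    case True
    then consider "p \<in> set qs" | i where "i < length rs" "p = rs ! i"
      by (auto simp: in_set_conv_nth)
    then show ?thesis
    proof cases
      case 1
      then show ?thesis using Iq ar(1) tuples_length by metis
    next
      case 2
      then have "arity p = 2 * length (vars D)" using ar(2) by simp
      then show ?thesis using Ir[OF 2(1)] 2(2) length_tuple_pairs unfolding R_def by metis
    qed
  qed
  then have "interpretation_of_preds I'" by (simp add: interpretation_of_preds_def)
  moreover have UI': "agree U I I'" using Io dist(2) unfolding agree_def by (metis IntI emptyE)
  moreover have "holds M J cl"
    if J: "agree (U \<union> set (qs @ rs)) I' J" and cl: "cl \<in> clauses_Ef D c qs rs" for J cl
  proof (rule clauses_Ef_hold[OF D _ _ _ _ ne len(1) _ _ cl])
    show "agree U I J" by (rule agree_trans[OF UI' agree_mono[OF J]]) blast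
    show "fv c \<subseteq> set (vars D)" "preds c \<subseteq> U" using fm_over_as_assertion[OF c \<psi>] by auto
    show "has_fair_path M I D s \<and> eval M I s c" if "eval M I s (init D)" for s
      by (rule has_fair_path_models[OF c mo that])
    show "J q = tuples (vars D) (has_fair_path M I D)" if "q \<in> set qs" for q
      using J Iq[OF that] that by (simp add: agree_def)
    show "J (rs ! i) = tuple_pairs (length (vars D))
        (\<lambda>es es'. visit_time M I D i (state_of (vars D) es') < visit_time M I D i (state_of (vars D) es))"
      if "i < length (fair D)" for i
      using J Ir[of i] that len(2) by (simp add: agree_def R_def)
  qed
  ultimately show ?thesis unfolding extension_satisfying_def by blast
qed

lemma satisfying_assertion_Ef_unfair:
  assumes c: "as_assertion \<psi> = Some c" and q: "q \<notin> U" "arity q = length (vars D)"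
    and D: "prog_over U D" and \<psi>: "fm_over (vars D) U \<psi>" and I: "interpretation_of_preds I"
    and mo: "models M I D (Qu QEf \<psi>)"
  shows "extension_satisfying M U I (clauses_Ef_unfair D c q) (insert q U)"
proof -
  define I' where "I' = I(q := tuples (vars D) (has_fair_path M I D))"
  have "interpretation_of_preds I'"
    unfolding I'_def by (intro interpretation_upd[OF I]) (simp only: q(2) tuples_length)
  moreover have UI': "agree U I I'" unfolding I'_def by (rule agree_upd_fresh[OF q(1)])
  moreover have "holds M J cl" if J: "agree (insert q U) I' J" and cl: "cl \<in> clauses_Ef_unfair D c q" for J cl
  proof (rule clauses_Ef_unfair_hold[OF D _ _ _ _ _ cl])
    show "agree U I J" by (rule agree_trans[OF UI' agree_mono[OF J]]) blast
    show "fv c \<subseteq> set (vars D)" "preds c \<subseteq> U" using fm_over_as_assertion[OF c \<psi>] by auto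
    show "has_fair_path M I D s \<and> eval M I s c" if "eval M I s (init D)" for s
      by (rule has_fair_path_models[OF c mo that])
    show "J q = tuples (vars D) (has_fair_path M I D)"
      using J by (simp add: agree_def I'_def)
  qed
  ultimately show ?thesis unfolding extension_satisfying_def by blast
qed

lemma satisfying_assertion:
  assumes c: "as_assertion \<phi> = Some c" and D: "prog_over U D" and \<phi>: "fm_over (vars D) U \<phi>"
    and I: "interpretation_of_preds I" and mo: "models M I D \<phi>"
  shows "extension_satisfying M U I {Imp (at_copy 0 (init D)) [] (at_copy 0 c)} U"
proof -
  have "eval M J s c" if "agree U I J" "eval M J s (init D)" for J s
    using models_cong[OF D \<phi> that(1) mo] that(2)
    by (auto simp: models_def sat_state_def sat_as_assertion[OF c])
  then show ?thesis using I unfolding extension_satisfying_def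
    by (intro exI[of _ I]) simp
qed

text \<open>\<open>I\<close> is generalized in the induction because recursive calls start from
  interpretations already extended by their auxiliary predicates.\<close>

lemma translates_satisfying:
  assumes "translates U D \<phi> C U'" and tf: "true_of M \<noteq> false_of M"
  shows "prog_over U D \<Longrightarrow> fm_over (vars D) U \<phi> \<Longrightarrow> interpretation_of_preds I \<Longrightarrow>
    models M I D \<phi> \<Longrightarrow> extension_satisfying M U I C U'"
  using assms(1)
proof (induction arbitrary: I rule: translates.induct)
  case (split_state \<psi> \<phi>1 q aux U D \<phi>2 \<phi>2' C1 U1 C2 U2)
  show ?case
    by (rule satisfying_split_state[OF split_state.prems split_state.hyps(2-5)
          translates_mono[OF split_state.hyps(6)] translates_mono[OF split_state.hyps(7)]])
      (use split_state.IH in simp_all)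
next
  case (path_A \<psi> U D C U')
  \<comment> \<open>Once the fairness list is empty every path is fair; quantifier-freeness of
    \<open>\<psi>\<close> ensures that emptying it does not change the meaning of
    \<open>\<psi>\<close> itself.\<close>
  have "models M I (D\<lparr>fair := []\<rparr>) (Qu QAf \<psi>)"
    using path_A.prems(4) sat_quantifier_free[OF path_A.hyps(1), of M I D _ "D\<lparr>fair := []\<rparr>"]
    by (simp add: models_Qu fair_path_no_fairness)
  then show ?case
    using path_A.prems by (intro path_A.IH) (simp_all add: prog_over_no_fairness fm_over_def)
next
  case (path_E \<psi> U D C U')
  have "models M I (D\<lparr>fair := []\<rparr>) (Qu QEf \<psi>)"
    using path_E.prems(4) sat_quantifier_free[OF path_E.hyps(1), of M I D _ "D\<lparr>fair := []\<rparr>"]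
    by (simp add: models_Qu fair_path_no_fairness)
  then show ?case
    using path_E.prems by (intro path_E.IH) (simp_all add: prog_over_no_fairness fm_over_def)
next
  case (temporal_Af \<psi> D x \<theta> a js \<psi>' U C U')
  have \<psi>: "fm_over (vars D) U \<psi>" using temporal_Af.prems(2) by (simp add: fm_over_def)
  show ?case
  proof (rule temporal_Af.IH)
    show "prog_over U (extend_prog D x a js)"
      by (rule extend_prog_over[OF temporal_Af.hyps(2)
            replaces_fm_over_subformula[OF temporal_Af.hyps(3) \<psi>] temporal_Af.prems(1)])
    show "fm_over (vars (extend_prog D x a js)) U (Qu QAf \<psi>')"
      using extend_prog_fm_over[OF temporal_Af.hyps(2,3) \<psi>] by (simp add: fm_over_def)
    show "models M I (extend_prog D x a js) (Qu QAf \<psi>')"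
      by (rule models_temporal_Af[OF temporal_Af.hyps(1-3) tf temporal_Af.prems(4)])
  qed (rule temporal_Af.prems)
next
  case (temporal_Ef \<psi> D x \<theta> a js \<psi>' aux U C U')
  have \<psi>: "fm_over (vars D) U \<psi>" using temporal_Ef.prems(2) by (simp add: fm_over_def)
  show ?case
    by (rule satisfying_temporal_Ef[OF temporal_Ef.hyps(1-3) tf temporal_Ef.hyps(4,5)
          translates_mono[OF temporal_Ef.hyps(6)] temporal_Ef.prems(1) \<psi> temporal_Ef.prems(3,4)])
      (use temporal_Ef.IH in simp)
next
  case (assertion_Af \<psi> c p r t U D)
  have \<psi>: "fm_over (vars D) U \<psi>" using assertion_Af.prems(2) by (simp add: fm_over_def)
  show ?case
    by (rule satisfying_assertion_Af[OF assertion_Af.hyps assertion_Af.prems(1) \<psi> assertion_Af.prems(3,4)])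
next
  case (assertion_Ef \<psi> c D qs rs U)
  have \<psi>: "fm_over (vars D) U \<psi>" using assertion_Ef.prems(2) by (simp add: fm_over_def)
  show ?case
    by (rule satisfying_assertion_Ef[OF assertion_Ef.hyps assertion_Ef.prems(1) \<psi> assertion_Ef.prems(3,4)])
next
  case (assertion_Ef_unfair \<psi> c D q U)
  have \<psi>: "fm_over (vars D) U \<psi>" using assertion_Ef_unfair.prems(2) by (simp add: fm_over_def)
  show ?case
    by (rule satisfying_assertion_Ef_unfair[OF assertion_Ef_unfair.hyps(1,3,4)
          assertion_Ef_unfair.prems(1) \<psi> assertion_Ef_unfair.prems(3,4)])
next
  case (assertion \<phi> c U D)
  then show ?case by (intro satisfying_assertion)
qed

theorem theorem3:
  fixes M :: "('f, 'r, 'e) struct" and I :: "'e interp"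
    and D :: "('f, 'r) prog" and \<phi> :: "('f, 'r, nat) fm ctl" and C :: "('f, 'r) clause set"
  assumes "true_of M \<noteq> false_of M"
    and "program D"
    and "ctl_star_formula (vars D) \<phi>"
    and "interpretation_of_preds I"
    and "models M I D \<phi>"
    and "Clauses D \<phi> C"
  shows "satisfiable M C"
proof -
  let ?U = "preds_prog D \<union> \<Union> (preds ` assertions \<phi>)"
  obtain U' where tr: "translates ?U D \<phi> C U'" using assms(6) by (auto simp: Clauses_def)
  have "prog_over ?U D" using assms(2) by (auto simp: program_def prog_over_def)
  moreover have "fm_over (vars D) ?U \<phi>"
    using assms(3) by (auto simp: ctl_star_formula_def fm_over_def)
  ultimately have "extension_satisfying M ?U I C U'"
    using translates_satisfying[OF tr assms(1)] assms(4,5) by blast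
  \<comment> \<open>The extension found is one of the interpretations \<open>J\<close> that agree
    with it.\<close>
  then show ?thesis unfolding extension_satisfying_def satisfiable_def using agree_refl by blast
qed

end
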